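(* Let $G$ be a compact Lie group with Lie algebra $\mathfrak g$, $X\in\mathfrak g$, $q\in C^\infty(G)$, and $q_0=\int_Gq(x)\,dx$. Let $L_q=X+q$ and $L_{q_0}=X+q_0$. Assume that there exists $Q\in C^\infty(G)$ such that $XQ=q-q_0$. Then: 1. $L_q\circ e^{-Q}=e^{-Q}\circ L_{q_0}$, both on $C^\infty(G)$ and on $\mathcal D'(G)$; 2. $L_q$ is globally hypoelliptic if and only if $L_{q_0}$ is globally hypoelliptic; 3. $L_q$ is globally hypoelliptic modulo $\ker L_q$ if and only if $L_{q_0}$ is globally hypoelliptic modulo $\ker L_{q_0}$.
   Context: $C^\infty(G)$ denotes complex-valued smooth functions, $\mathcal D'(G)$ the space of distributions (continuous linear functionals on the Fréchet space $C^\infty(G)$), and $dx$ the normalized Haar measure. $X$ acts as the left-invariant vector field $Xf(x)=\frac{d}{dt}f(x\exp(tX))|_{t=0}$. For $q\in C^\infty(G)$, $L_qu=Xu+qu$ for $u\in C^\infty(G)$, extended to $u\in\mathcal D'(G)$ by $\langle L_qu,\varphi\rangle=-\langle u,X\varphi\rangle+\langle u,q\varphi\rangle$, $\varphi\in C^\infty(G)$. Here $e^{-Q}$ denotes the operator of multiplication by the function $e^{-Q}$. An operator $P:\mathcal D'(G)\to\mathcal D'(G)$ is globally hypoelliptic if $u\in\mathcal D'(G)$ and $Pu\in C^\infty(G)$ imply $u\in C^\infty(G)$. It is globally hypoelliptic modulo $\ker P$ if whenever $u\in\mathcal D'(G)$ and $Pu\in C^\infty(G)$, there exists $v\in C^\infty(G)$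 such that $u-v\in\ker P$. *)

theory Defs
  imports "HOL-Analysis.Analysis" "HOL-Probability.Probability_Measure"
begin

section \<open>Smooth maps between open subsets of normed spaces\<close>

text \<open>\<open>iter_deriv [v\<^sub>1, \<dots>, v\<^sub>k] f\<close> is the iterated directional derivative of \<open>f\<close> in the
  directions \<open>v\<^sub>k, \<dots>, v\<^sub>1\<close> (a mixed partial derivative when the \<open>v\<^sub>i\<close> are basis vectors).\<close>

fun iter_deriv :: "'a::real_normed_vector list \<Rightarrow> ('a \<Rightarrow> 'b::real_normed_vector) \<Rightarrow> 'a \<Rightarrow> 'b" where
  "iter_deriv [] f = f"
| "iter_deriv (v # vs) f = (\<lambda>x. frechet_derivative (iter_deriv vs f) (at x) v)"

text \<open>Only used for open \<open>S\<close> in finite-dimensional spaces, where this is \<open>C\<^sup>\<infinity>\<close> smoothness: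
  differentiability of all derivatives includes their continuity.\<close>

definition smooth_on :: "'a::real_normed_vector set \<Rightarrow> ('a \<Rightarrow> 'b::real_normed_vector) \<Rightarrow> bool" where
  "smooth_on S f \<longleftrightarrow> (\<forall>vs. \<forall>x\<in>S. iter_deriv vs f differentiable (at x))"

section \<open>Lie groups\<close>

text \<open>A chart \<open>(U, \<phi>)\<close> maps an open set \<open>U\<close> of the manifold onto an open subset of the model space
  \<open>'e\<close>; the values of \<open>\<phi>\<close> outside \<open>U\<close> are irrelevant.  The model space is a finite-dimensional
  inner product space rather than an instance of \<^class>\<open>euclidean_space\<close>, because the latter class
  excludes dimension 0, that is, finite groups.\<close>

type_synonym ('g, 'e) atlas = "('g set \<times> ('g \<Rightarrow> 'e)) set"

definition smooth_atlas :: "('g::{t2_space,second_countable_topology}, 'e::real_inner) atlas \<Rightarrow> bool" where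
  "smooth_atlas A \<longleftrightarrow>
     (\<exists>B :: 'e set. finite B \<and> span B = UNIV) \<and>
     (\<Union>(U, \<phi>)\<in>A. U) = UNIV \<and>
     (\<forall>(U, \<phi>)\<in>A. open U \<and> open (\<phi> ` U) \<and> homeomorphism U (\<phi> ` U) \<phi> (inv_into U \<phi>)) \<and>
     (\<forall>(U, \<phi>)\<in>A. \<forall>(V, \<psi>)\<in>A. smooth_on (\<phi> ` (U \<inter> V)) (\<psi> \<circ> inv_into U \<phi>))"

definition smooth_mult :: "('g::topological_space, 'e::real_inner) atlas \<Rightarrow> ('g \<Rightarrow> 'g \<Rightarrow> 'g) \<Rightarrow> bool" where
  "smooth_mult A gmul \<longleftrightarrow>
     continuous_on UNIV (\<lambda>(x, y). gmul x y) \<and>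
     (\<forall>(U, \<phi>)\<in>A. \<forall>(V, \<psi>)\<in>A. \<forall>(W, \<eta>)\<in>A.
        smooth_on {(a, b). a \<in> \<phi> ` U \<and> b \<in> \<psi> ` V \<and> gmul (inv_into U \<phi> a) (inv_into V \<psi> b) \<in> W}
          (\<lambda>(a, b). \<eta> (gmul (inv_into U \<phi> a) (inv_into V \<psi> b))))"

definition smooth_inverse :: "('g::topological_space, 'e::real_inner) atlas \<Rightarrow> ('g \<Rightarrow> 'g) \<Rightarrow> bool" where
  "smooth_inverse A inver \<longleftrightarrow>
     continuous_on UNIV inver \<and>
     (\<forall>(U, \<phi>)\<in>A. \<forall>(W, \<eta>)\<in>A.
        smooth_on {a. a \<in> \<phi> ` U \<and> inver (inv_into U \<phi> a) \<in> W} (\<lambda>a. \<eta> (inver (inv_into U \<phi> a))))"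

text \<open>\<open>Groups.group\<close> is the (not necessarily commutative) group locale of Main.\<close>

definition compact_lie_group ::
  "('g::{t2_space,second_countable_topology} \<Rightarrow> 'g \<Rightarrow> 'g) \<Rightarrow> 'g \<Rightarrow> ('g \<Rightarrow> 'g) \<Rightarrow>
   ('g, 'e::real_inner) atlas \<Rightarrow> bool" where
  "compact_lie_group gmul e inver A \<longleftrightarrow>
     Groups.group gmul e inver \<and> smooth_atlas A \<and> smooth_mult A gmul \<and> smooth_inverse A inver \<and>
     compact (UNIV :: 'g set)"

definition smooth_functions ::
  "('g, 'e::real_inner) atlas \<Rightarrow> ('g \<Rightarrow> 'b::real_normed_vector) set" where
  "smooth_functions A = {f. \<forall>(U, \<phi>)\<in>A. smooth_on (\<phi> ` U) (f \<circ> inv_into U \<phi>)}"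

abbreviation Cinf :: "('g, 'e::real_inner) atlas \<Rightarrow> ('g \<Rightarrow> complex) set" where
  "Cinf A \<equiv> smooth_functions A"

abbreviation Cinf_real :: "('g, 'e::real_inner) atlas \<Rightarrow> ('g \<Rightarrow> real) set" where
  "Cinf_real A \<equiv> smooth_functions A"

definition smooth_curve :: "('g::topological_space, 'e::real_inner) atlas \<Rightarrow> (real \<Rightarrow> 'g) \<Rightarrow> bool" where
  "smooth_curve A \<gamma> \<longleftrightarrow>
     continuous_on UNIV \<gamma> \<and> (\<forall>(U, \<phi>)\<in>A. smooth_on (\<gamma> -` U) (\<phi> \<circ> \<gamma>))"

section \<open>Lie algebra and exponential map\<close>

text \<open>The Lie algebra as a vector space: the tangent space at the identity \<open>e\<close>, i.e. the point
  derivations at \<open>e\<close> of the algebra of real-valued smooth functions.  (The bracket is not needed.)\<close>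

definition lie_algebra :: "'g \<Rightarrow> ('g, 'e::real_inner) atlas \<Rightarrow> (('g \<Rightarrow> real) \<Rightarrow> real) set" where
  "lie_algebra e A = {X \<in> extensional (Cinf_real A).
     (\<forall>f\<in>Cinf_real A. \<forall>g\<in>Cinf_real A. X (\<lambda>x. f x + g x) = X f + X g) \<and>
     (\<forall>c. \<forall>f\<in>Cinf_real A. X (\<lambda>x. c * f x) = c * X f) \<and>
     (\<forall>f\<in>Cinf_real A. \<forall>g\<in>Cinf_real A. X (\<lambda>x. f x * g x) = X f * g e + f e * X g)}"

definition lie_scale ::
  "('g, 'e::real_inner) atlas \<Rightarrow> real \<Rightarrow> (('g \<Rightarrow> real) \<Rightarrow> real) \<Rightarrow> (('g \<Rightarrow> real) \<Rightarrow> real)" where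
  "lie_scale A t X = (\<lambda>f\<in>Cinf_real A. t * X f)"

text \<open>The exponential map: \<open>t \<mapsto> exp (t X)\<close> is the one-parameter subgroup with velocity \<open>X\<close> at
  \<open>t = 0\<close>.  On a Lie group such a map exists and is unique on the Lie algebra.\<close>

definition exponential_map ::
  "('g::topological_space \<Rightarrow> 'g \<Rightarrow> 'g) \<Rightarrow> 'g \<Rightarrow> ('g, 'e::real_inner) atlas \<Rightarrow>
   ((('g \<Rightarrow> real) \<Rightarrow> real) \<Rightarrow> 'g) \<Rightarrow> bool" where
  "exponential_map gmul e A expG \<longleftrightarrow>
     (\<forall>X\<in>lie_algebra e A.
        smooth_curve A (\<lambda>t. expG (lie_scale A t X)) \<and>
        (\<forall>s t. expG (lie_scale A (s + t) X) = gmul (expG (lie_scale A s X)) (expG (lie_scale A t X))) \<and>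
        (\<forall>f\<in>Cinf_real A. ((\<lambda>t. f (expG (lie_scale A t X))) has_real_derivative X f) (at 0)))"

text \<open>The action of \<open>X\<close> as a left-invariant vector field,
  \<open>X f (x) = d/dt f (x exp (t X))\<close> at \<open>t = 0\<close>.\<close>

definition vector_field ::
  "('g \<Rightarrow> 'g \<Rightarrow> 'g) \<Rightarrow> ('g, 'e::real_inner) atlas \<Rightarrow> ((('g \<Rightarrow> real) \<Rightarrow> real) \<Rightarrow> 'g) \<Rightarrow>
   (('g \<Rightarrow> real) \<Rightarrow> real) \<Rightarrow> ('g \<Rightarrow> complex) \<Rightarrow> 'g \<Rightarrow> complex" where
  "vector_field gmul A expG X f x =
     vector_derivative (\<lambda>t. f (gmul x (expG (lie_scale A t X)))) (at 0)"

section \<open>Normalized Haar measure\<close>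

text \<open>On a compact second countable group a left-invariant Borel probability measure is unique,
  and automatically regular and bi-invariant.\<close>

definition normalized_haar ::
  "('g::topological_space \<Rightarrow> 'g \<Rightarrow> 'g) \<Rightarrow> 'g measure \<Rightarrow> bool" where
  "normalized_haar gmul \<mu> \<longleftrightarrow>
     sets \<mu> = sets borel \<and> prob_space \<mu> \<and> (\<forall>a. distr \<mu> borel (gmul a) = \<mu>)"

section \<open>Distributions\<close>

definition Cinf_seminorm :: "'g set \<times> ('g \<Rightarrow> 'e::real_inner) \<Rightarrow> 'e set \<Rightarrow> 'e list \<Rightarrow> ('g \<Rightarrow> complex) \<Rightarrow> real" where
  "Cinf_seminorm c K vs f =
     (case c of (U, \<phi>) \<Rightarrow> SUP y\<in>K. cmod (iter_deriv vs (f \<circ> inv_into U \<phi>) y))"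

text \<open>The Frechet topology of uniform convergence of all derivatives on compact subsets of charts.\<close>

definition Cinf_topology :: "('g, 'e::real_inner) atlas \<Rightarrow> ('g \<Rightarrow> complex) topology" where
  "Cinf_topology A = topology_generated_by
     {{g \<in> Cinf A. Cinf_seminorm (U, \<phi>) K vs (\<lambda>x. g x - f x) < \<epsilon>} | U \<phi> K vs f \<epsilon>.
        (U, \<phi>) \<in> A \<and> compact K \<and> K \<noteq> {} \<and> K \<subseteq> \<phi> ` U \<and> f \<in> Cinf A \<and> \<epsilon> > 0}"

text \<open>Functionals on \<open>Cinf A\<close> are taken to be \<^const>\<open>undefined\<close> off \<open>Cinf A\<close>, so that equality in HOL
  is equality of distributions.\<close>

definition distributions :: "('g, 'e::real_inner) atlas \<Rightarrow> (('g \<Rightarrow> complex) \<Rightarrow> complex) set" where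
  "distributions A = {u \<in> extensional (Cinf A).
     (\<forall>f\<in>Cinf A. \<forall>g\<in>Cinf A. u (\<lambda>x. f x + g x) = u f + u g) \<and>
     (\<forall>c. \<forall>f\<in>Cinf A. u (\<lambda>x. c * f x) = c * u f) \<and>
     continuous_map (Cinf_topology A) euclidean u}"

text \<open>The usual inclusion of smooth functions in the distributions.\<close>

definition dist_of ::
  "('g, 'e::real_inner) atlas \<Rightarrow> 'g measure \<Rightarrow> ('g \<Rightarrow> complex) \<Rightarrow> (('g \<Rightarrow> complex) \<Rightarrow> complex)" where
  "dist_of A \<mu> f = (\<lambda>\<phi>\<in>Cinf A. \<integral>x. f x * \<phi> x \<partial>\<mu>)"

definition dist_zero :: "('g, 'e::real_inner) atlas \<Rightarrow> (('g \<Rightarrow> complex) \<Rightarrow> complex)" where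
  "dist_zero A = (\<lambda>\<phi>\<in>Cinf A. 0)"

definition dist_minus ::
  "('g, 'e::real_inner) atlas \<Rightarrow> (('g \<Rightarrow> complex) \<Rightarrow> complex) \<Rightarrow> (('g \<Rightarrow> complex) \<Rightarrow> complex) \<Rightarrow>
   (('g \<Rightarrow> complex) \<Rightarrow> complex)" where
  "dist_minus A u v = (\<lambda>\<phi>\<in>Cinf A. u \<phi> - v \<phi>)"

section \<open>The operators\<close>

definition mult_op :: "('g \<Rightarrow> complex) \<Rightarrow> ('g \<Rightarrow> complex) \<Rightarrow> ('g \<Rightarrow> complex)" where
  "mult_op h u = (\<lambda>x. h x * u x)"

definition mult_op_dist ::
  "('g, 'e::real_inner) atlas \<Rightarrow> ('g \<Rightarrow> complex) \<Rightarrow> (('g \<Rightarrow> complex) \<Rightarrow> complex) \<Rightarrow>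
   (('g \<Rightarrow> complex) \<Rightarrow> complex)" where
  "mult_op_dist A h u = (\<lambda>\<phi>\<in>Cinf A. u (mult_op h \<phi>))"

definition L_op ::
  "('g \<Rightarrow> 'g \<Rightarrow> 'g) \<Rightarrow> ('g, 'e::real_inner) atlas \<Rightarrow> ((('g \<Rightarrow> real) \<Rightarrow> real) \<Rightarrow> 'g) \<Rightarrow>
   (('g \<Rightarrow> real) \<Rightarrow> real) \<Rightarrow> ('g \<Rightarrow> complex) \<Rightarrow> ('g \<Rightarrow> complex) \<Rightarrow> ('g \<Rightarrow> complex)" where
  "L_op gmul A expG X q u = (\<lambda>x. vector_field gmul A expG X u x + q x * u x)"

definition L_op_dist ::
  "('g \<Rightarrow> 'g \<Rightarrow> 'g) \<Rightarrow> ('g, 'e::real_inner) atlas \<Rightarrow> ((('g \<Rightarrow> real) \<Rightarrow> real) \<Rightarrow> 'g) \<Rightarrow>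
   (('g \<Rightarrow> real) \<Rightarrow> real) \<Rightarrow> ('g \<Rightarrow> complex) \<Rightarrow> (('g \<Rightarrow> complex) \<Rightarrow> complex) \<Rightarrow>
   (('g \<Rightarrow> complex) \<Rightarrow> complex)" where
  "L_op_dist gmul A expG X q u =
     (\<lambda>\<phi>\<in>Cinf A. - u (vector_field gmul A expG X \<phi>) + u (\<lambda>x. q x * \<phi> x))"

section \<open>Global hypoellipticity\<close>

text \<open>A distribution \<open>u\<close> is smooth if it lies in \<open>dist_of A \<mu> ` Cinf A\<close>.\<close>

definition kernel ::
  "('g, 'e::real_inner) atlas \<Rightarrow> ((('g \<Rightarrow> complex) \<Rightarrow> complex) \<Rightarrow> (('g \<Rightarrow> complex) \<Rightarrow> complex)) \<Rightarrow>
   (('g \<Rightarrow> complex) \<Rightarrow> complex) set" where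
  "kernel A P = {u \<in> distributions A. P u = dist_zero A}"

definition globally_hypoelliptic ::
  "('g, 'e::real_inner) atlas \<Rightarrow> 'g measure \<Rightarrow>
   ((('g \<Rightarrow> complex) \<Rightarrow> complex) \<Rightarrow> (('g \<Rightarrow> complex) \<Rightarrow> complex)) \<Rightarrow> bool" where
  "globally_hypoelliptic A \<mu> P \<longleftrightarrow>
     (\<forall>u\<in>distributions A. P u \<in> dist_of A \<mu> ` Cinf A \<longrightarrow> u \<in> dist_of A \<mu> ` Cinf A)"

definition globally_hypoelliptic_mod_kernel ::
  "('g, 'e::real_inner) atlas \<Rightarrow> 'g measure \<Rightarrow>
   ((('g \<Rightarrow> complex) \<Rightarrow> complex) \<Rightarrow> (('g \<Rightarrow> complex) \<Rightarrow> complex)) \<Rightarrow> bool" where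
  "globally_hypoelliptic_mod_kernel A \<mu> P \<longleftrightarrow>
     (\<forall>u\<in>distributions A. P u \<in> dist_of A \<mu> ` Cinf A \<longrightarrow>
        (\<exists>v\<in>Cinf A. dist_minus A u (dist_of A \<mu> v) \<in> kernel A P))"

end

theory Submission
  imports Defs
begin

text \<open>By the Leibniz rule along the flow, \<open>X (e\<^sup>-\<^sup>Q u) = e\<^sup>-\<^sup>Q (X u - (q - q\<^sub>0) u)\<close>, which is the conjugation
  formula on functions; on distributions it follows by testing against \<open>\<phi>\<close>, because \<open>X\<close> preserves
  smoothness.  Multiplication by \<open>e\<^sup>-\<^sup>Q\<close> is a bijection of the distributions that preserves the smooth
  ones and, by the formula, carries \<open>ker L\<^sub>q\<^sub>0\<close> to \<open>ker L\<^sub>q\<close>, so both forms of hypoellipticity transfer;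
  the converse directions are the same statement for \<open>-Q\<close>.\<close>

section \<open>Calculus of smooth maps\<close>

text \<open>Two analytic facts carry the weight. \<open>XF f\<close> is smooth again, because in
  charts it is a partial derivative of \<open>(a, b) \<mapsto> f (a b)\<close> in the second
  variable at the identity, along a fixed vector. Multiplication by a smooth function is continuous
  in the Frechet topology, so \<open>e^{-Q} u\<close> is again a distribution and hypoellipticity
  can be applied to it. The obstacle is that smoothness speaks of all words of directions at once.
  Closure properties therefore go through invariant families of functions, and the product estimate
  is an inequality with unspecified constants, uniform in one factor. The constant \<open>q0\<close>
  is replaced by an arbitrary smooth \<open>p\<close> with \<open>XQ = q - p\<close>: this relation
  is symmetric under exchanging \<open>q\<close> with \<open>p\<close> and \<open>Q\<close> with
  \<open>-Q\<close>, whereas the one with \<open>q0\<close> is not of the same form after the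
  exchange.\<close>

lemma frechet_derivative_cong_open:
  assumes "open S" "x \<in> S" "\<And>y. y \<in> S \<Longrightarrow> f y = g y"
  shows "frechet_derivative f (at x) = frechet_derivative g (at x)"
proof -
  \<comment> \<open>\<open>frechet_derivative\<close> is a choice among the derivatives. Equivalence
    for every \<open>D\<close> makes the two choices equal even at points where neither function is
    differentiable.\<close>
  have "(f has_derivative D) (at x) \<longleftrightarrow> (g has_derivative D) (at x)" for D
    using assms has_derivative_transform_within_open[of f D x UNIV S g]
      has_derivative_transform_within_open[of g D x UNIV S f] by auto
  then show ?thesis
    unfolding frechet_derivative_def by simp
qed

lemma differentiable_cong_open:
  assumes "open S" "x \<in> S" "\<And>y. y \<in> S \<Longrightarrow> f y = g y" "g differentiable (at x)"
  shows "f differentiable (at x)"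
  using assms has_derivative_transform_within_open[of g _ x UNIV S f]
  unfolding differentiable_def by metis

lemma iter_deriv_append: "iter_deriv (vs @ ws) f = iter_deriv vs (iter_deriv ws f)"
  by (induction vs) auto

lemma iter_deriv_cong_open:
  assumes "open S" "\<And>y. y \<in> S \<Longrightarrow> f y = g y" "x \<in> S"
  shows "iter_deriv vs f x = iter_deriv vs g x"
  using assms(3)
proof (induction vs arbitrary: x)
  case (Cons v vs)
  then show ?case
    using frechet_derivative_cong_open[OF assms(1) Cons.prems, of "iter_deriv vs f" "iter_deriv vs g"]
    by simp
qed (use assms in auto)

lemma iter_deriv_zero: "iter_deriv vs (\<lambda>x. 0) = (\<lambda>x. 0)"
  by (induction vs) auto

lemma smooth_on_cong:
  assumes "open S" "\<And>y. y \<in> S \<Longrightarrow> f y = g y" "smooth_on S g"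
  shows "smooth_on S f"
  unfolding smooth_on_def
proof safe
  fix vs x assume "x \<in> S"
  then show "iter_deriv vs f differentiable (at x)"
    using differentiable_cong_open[OF assms(1) \<open>x \<in> S\<close>, of "iter_deriv vs f" "iter_deriv vs g"]
      iter_deriv_cong_open[OF assms(1,2)] assms(3)[unfolded smooth_on_def] by auto
qed

text \<open>\<open>smooth_on\<close> asks for differentiability at each point separately, so
  \<open>T\<close> may vary with the point. This permits changing the target chart from point to
  point.\<close>

lemma smooth_on_local:
  assumes "\<And>x. x \<in> S \<Longrightarrow> \<exists>T. x \<in> T \<and> smooth_on T f"
  shows "smooth_on S f"
  using assms unfolding smooth_on_def by blast

lemma smooth_on_differentiable: "smooth_on S f \<Longrightarrow> x \<in> S \<Longrightarrow> f differentiable (at x)"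
  unfolding smooth_on_def by (metis iter_deriv.simps(1))

lemma smooth_on_iter_deriv: "smooth_on S f \<Longrightarrow> smooth_on S (iter_deriv vs f)"
  unfolding smooth_on_def by (simp flip: iter_deriv_append)

lemma smooth_on_frechet_derivative:
  assumes "smooth_on S f" shows "smooth_on S (\<lambda>x. frechet_derivative f (at x) v)"
  using smooth_on_iter_deriv[OF assms, of "[v]"] by simp

lemma smooth_on_has_derivative:
  "smooth_on S f \<Longrightarrow> x \<in> S \<Longrightarrow> (f has_derivative frechet_derivative f (at x)) (at x)"
  using smooth_on_differentiable frechet_derivative_works by blast

lemma frechet_derivativeI: "(f has_derivative D) (at x) \<Longrightarrow> frechet_derivative f (at x) = D"
  using frechet_derivative_at by fastforce

text \<open>Sums suffice without scalar multiples: the families to which this is applied absorb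
  coefficients into their members. \<open>zero\<close> accounts for derivatives of constants and for
  empty sums.\<close>

inductive_set additive_closure :: "('a \<Rightarrow> 'b::real_normed_vector) set \<Rightarrow> ('a \<Rightarrow> 'b) set"
  for F where
  base: "f \<in> F \<Longrightarrow> f \<in> additive_closure F"
| zero: "(\<lambda>x. 0) \<in> additive_closure F"
| add: "f \<in> additive_closure F \<Longrightarrow> g \<in> additive_closure F \<Longrightarrow> (\<lambda>x. f x + g x) \<in> additive_closure F"

lemma additive_closure_sum:
  "(\<And>i. i \<in> I \<Longrightarrow> f i \<in> additive_closure F) \<Longrightarrow> (\<lambda>x. \<Sum>i\<in>I. f i x) \<in> additive_closure F"
  by (induction I rule: infinite_finite_induct) (auto intro: additive_closure.intros)

text \<open>Smoothness is a greatest fixed point: it suffices to exhibit a family of differentiable functions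
  whose directional derivatives are finite sums of members of the family.  The chain rule and the
  product rule then need no explicit formula for higher derivatives.\<close>

lemma smooth_on_coinduct:
  fixes f :: "'a::real_normed_vector \<Rightarrow> 'b::real_normed_vector"
  assumes S: "open S" and "f \<in> F"
    and diff: "\<And>g x. g \<in> F \<Longrightarrow> x \<in> S \<Longrightarrow> g differentiable (at x)"
    and step: "\<And>g v. g \<in> F \<Longrightarrow>
      \<exists>h\<in>additive_closure F. \<forall>x\<in>S. frechet_derivative g (at x) v = h x"
  shows "smooth_on S f"
proof -
  have diff': "g differentiable (at x)" if "g \<in> additive_closure F" "x \<in> S" for g x
    using that by induction (auto intro: diff)
  have step': "\<exists>h\<in>additive_closure F. \<forall>x\<in>S. frechet_derivative g (at x) v = h x"
    if "g \<in> additive_closure F" for g v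
    using that
  proof induction
    case (base f)
    then show ?case by (rule step)
  next
    case zero
    then show ?case by (auto intro: additive_closure.zero)
  next
    case (add f g)
    then obtain h k where hk: "h \<in> additive_closure F" "k \<in> additive_closure F"
      "\<forall>x\<in>S. frechet_derivative f (at x) v = h x"
      "\<forall>x\<in>S. frechet_derivative g (at x) v = k x" by blast
    have "frechet_derivative (\<lambda>x. f x + g x) (at x) v = h x + k x" if "x \<in> S" for x
    proof -
      have "((\<lambda>x. f x + g x) has_derivative
          (\<lambda>v. frechet_derivative f (at x) v + frechet_derivative g (at x) v)) (at x)"
        using diff'[OF add.hyps(1) that] diff'[OF add.hyps(2) that]
        by (intro has_derivative_add) (auto simp flip: frechet_derivative_works)
      from frechet_derivativeI[OF this] show ?thesis using hk that by simp
    qed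
    then show ?case
      by (intro bexI[OF _ additive_closure.add[OF hk(1,2)]] ballI)
  qed
  \<comment> \<open>Agreement is claimed only on \<open>S\<close>; since \<open>S\<close> is open,
    it survives differentiation.\<close>
  have iter: "\<exists>h\<in>additive_closure F. \<forall>x\<in>S. iter_deriv vs f x = h x" for vs
  proof (induction vs)
    case Nil
    then show ?case using \<open>f \<in> F\<close> additive_closure.base by auto
  next
    case (Cons v vs)
    then obtain h where h: "h \<in> additive_closure F" "\<forall>x\<in>S. iter_deriv vs f x = h x" by blast
    then have "\<forall>x\<in>S. iter_deriv (v # vs) f x = frechet_derivative h (at x) v"
      using frechet_derivative_cong_open[OF S, of _ "iter_deriv vs f" h] by simp
    with step'[OF h(1), of v] show ?case by auto
  qed
  show ?thesis
    unfolding smooth_on_def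
    using iter diff' differentiable_cong_open[OF S] by metis
qed

section \<open>Smoothness of sums, products, compositions, the exponential and slices\<close>

lemma smooth_on_const: "open S \<Longrightarrow> smooth_on S (\<lambda>x. c)"
  by (rule smooth_on_coinduct[where F = "range (\<lambda>c x. c)"])
    (auto intro!: bexI[OF _ additive_closure.zero])

lemma smooth_on_add:
  fixes f g :: "'a::real_normed_vector \<Rightarrow> 'b::real_normed_vector"
  assumes "open S" "smooth_on S f" "smooth_on S g"
  shows "smooth_on S (\<lambda>x. f x + g x)"
proof (rule smooth_on_coinduct[where F = "{\<lambda>x. f x + g x |f g. smooth_on S f \<and> smooth_on S g}"])
  fix h :: "'a \<Rightarrow> 'b" and v assume "h \<in> {\<lambda>x. f x + g x |f g. smooth_on S f \<and> smooth_on S g}"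
  then obtain f g where h: "h = (\<lambda>x. f x + g x)" and fg: "smooth_on S f" "smooth_on S g" by auto
  have "frechet_derivative h (at x) v = frechet_derivative f (at x) v + frechet_derivative g (at x) v"
    if "x \<in> S" for x
    unfolding h
    using frechet_derivativeI[OF has_derivative_add[OF fg[THEN smooth_on_has_derivative, OF that]]] by simp
  moreover have "(\<lambda>x. frechet_derivative f (at x) v + frechet_derivative g (at x) v) \<in>
      {\<lambda>x. f x + g x |f g. smooth_on S f \<and> smooth_on S g}"
    by (intro CollectI exI conjI, rule refl) (intro fg[THEN smooth_on_frechet_derivative])+
  ultimately show "\<exists>k\<in>additive_closure {\<lambda>x. f x + g x |f g. smooth_on S f \<and> smooth_on S g}.
      \<forall>x\<in>S. frechet_derivative h (at x) v = k x"
    by (intro bexI[OF _ additive_closure.base] ballI) assumption+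
qed (use assms smooth_on_differentiable in \<open>auto intro!: differentiable_add\<close>)

lemma smooth_on_bounded_linear:
  assumes "open S" "smooth_on S f" "bounded_linear L"
  shows "smooth_on S (\<lambda>x. L (f x))"
proof (rule smooth_on_coinduct[where F = "{\<lambda>x. L (f x) |f. smooth_on S f}"])
  fix h x assume "h \<in> {\<lambda>x. L (f x) |f. smooth_on S f}" and x: "x \<in> S"
  then obtain f where h: "h = (\<lambda>x. L (f x))" and f: "smooth_on S f" by auto
  show "h differentiable (at x)"
    unfolding h
    by (rule differentiableI[OF bounded_linear.has_derivative[OF assms(3)
            smooth_on_has_derivative[OF f x]]])
next
  fix h v assume "h \<in> {\<lambda>x. L (f x) |f. smooth_on S f}"
  then obtain f where h: "h = (\<lambda>x. L (f x))" and f: "smooth_on S f" by auto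
  have "frechet_derivative h (at x) v = L (frechet_derivative f (at x) v)"
    if "x \<in> S" for x
    unfolding h
    using frechet_derivativeI[OF bounded_linear.has_derivative[OF assms(3)
          smooth_on_has_derivative[OF f that]]] by simp
  then show "\<exists>k\<in>additive_closure {\<lambda>x. L (f x) |f. smooth_on S f}.
      \<forall>x\<in>S. frechet_derivative h (at x) v = k x"
    by (intro bexI[OF _ additive_closure.base]) (use smooth_on_frechet_derivative[OF f] in auto)
qed (use assms in auto)

lemma smooth_on_bilinear_has_derivative:
  assumes "bounded_bilinear pr" "smooth_on S f" "smooth_on S g" "x \<in> S"
  shows "((\<lambda>x. pr (f x) (g x)) has_derivative
      (\<lambda>v. pr (frechet_derivative f (at x) v) (g x) + pr (f x) (frechet_derivative g (at x) v))) (at x)"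
  using bounded_bilinear.FDERIV[OF assms(1) assms(2,3)[THEN smooth_on_has_derivative, OF assms(4)]]
  by (simp add: add.commute)

text \<open>All products of two smooth functions form the invariant family. A derivative is a sum of
  two such products, which is why the family need only be invariant up to sums.\<close>

lemma smooth_on_bilinear:
  assumes "open S" "smooth_on S f" "smooth_on S g" and pr: "bounded_bilinear pr"
  shows "smooth_on S (\<lambda>x. pr (f x) (g x))"
proof (rule smooth_on_coinduct[where F = "{\<lambda>x. pr (f x) (g x) |f g. smooth_on S f \<and> smooth_on S g}"])
  fix h x assume "h \<in> {\<lambda>x. pr (f x) (g x) |f g. smooth_on S f \<and> smooth_on S g}" and x: "x \<in> S"
  then obtain f g where h: "h = (\<lambda>x. pr (f x) (g x))" and fg: "smooth_on S f" "smooth_on S g" by auto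
  show "h differentiable (at x)"
    unfolding h by (rule differentiableI[OF smooth_on_bilinear_has_derivative[OF pr fg x]])
next
  fix h v assume "h \<in> {\<lambda>x. pr (f x) (g x) |f g. smooth_on S f \<and> smooth_on S g}"
  then obtain f g where h: "h = (\<lambda>x. pr (f x) (g x))" and fg: "smooth_on S f" "smooth_on S g" by auto
  have "frechet_derivative h (at x) v =
      pr (frechet_derivative f (at x) v) (g x) + pr (f x) (frechet_derivative g (at x) v)"
    if "x \<in> S" for x
    unfolding h using frechet_derivativeI[OF smooth_on_bilinear_has_derivative[OF pr fg that]] by simp
  moreover have "(\<lambda>x. pr (frechet_derivative f (at x) v) (g x)) \<in>
        {\<lambda>x. pr (f x) (g x) |f g. smooth_on S f \<and> smooth_on S g}"
    by (intro CollectI exI conjI, rule refl) (intro fg fg[THEN smooth_on_frechet_derivative])+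
  moreover have "(\<lambda>x. pr (f x) (frechet_derivative g (at x) v)) \<in>
        {\<lambda>x. pr (f x) (g x) |f g. smooth_on S f \<and> smooth_on S g}"
    by (intro CollectI exI conjI, rule refl) (intro fg fg[THEN smooth_on_frechet_derivative])+
  ultimately show "\<exists>k\<in>additive_closure {\<lambda>x. pr (f x) (g x) |f g. smooth_on S f \<and> smooth_on S g}.
      \<forall>x\<in>S. frechet_derivative h (at x) v = k x"
    by (intro bexI[OF _ additive_closure.add[OF additive_closure.base additive_closure.base]] ballI)
      assumption+
qed (use assms in auto)

lemmas smooth_on_mult = smooth_on_bilinear[OF _ _ _ bounded_bilinear_mult]

text \<open>Vectors of \<open>C\<close> may be zero; their terms vanish because \<open>0 / 0 = 0\<close>.\<close>

lemma orthogonal_expansion: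
  fixes x :: "'a::real_inner"
  assumes "finite C" "span C = UNIV" "pairwise orthogonal C"
  shows "x = (\<Sum>b\<in>C. (x \<bullet> b / (b \<bullet> b)) *\<^sub>R b)"
proof -
  \<comment> \<open>The residual is orthogonal to every member of \<open>C\<close>, hence to the
    whole span and to itself.\<close>
  define r where "r = x - (\<Sum>b\<in>C. (x \<bullet> b / (b \<bullet> b)) *\<^sub>R b)"
  have "orthogonal r c" if "c \<in> C" for c
  proof -
    have "(\<Sum>b\<in>C. (x \<bullet> b / (b \<bullet> b)) *\<^sub>R b) \<bullet> c = (\<Sum>b\<in>C. if b = c then x \<bullet> c else 0)"
      unfolding inner_sum_left using assms(3) that
      by (intro sum.cong) (auto simp: pairwise_def orthogonal_def)
    with that assms(1) show ?thesis
      by (simp add: r_def orthogonal_def inner_diff_left)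
  qed
  then have "orthogonal r r"
    using orthogonal_to_span[of r C r] assms(2) by simp
  then show ?thesis by (simp add: r_def orthogonal_self)
qed

text \<open>The derivative of \<open>g \<circ> f\<close> applies \<open>Dg (f x)\<close> to a
  direction \<open>Df x v\<close> that varies with \<open>x\<close>, so it is not of the form
  \<open>g' \<circ> f\<close>. Expanding that direction in a fixed finite orthogonal spanning set
  moves the dependence on \<open>x\<close> into scalar coefficients. Hence the family consists of
  the products \<open>c x *\<^sub>R g (f x)\<close>; the coefficients are inner products and thus
  smooth.\<close>

lemma smooth_on_compose:
  fixes f :: "'a::real_normed_vector \<Rightarrow> 'b::real_inner" and g :: "'b \<Rightarrow> 'c::real_normed_vector"
  assumes S: "open S" and f: "smooth_on S f" and g: "smooth_on T g" and fST: "f ` S \<subseteq> T"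
    and fd: "\<exists>B :: 'b set. finite B \<and> span B = UNIV"
  shows "smooth_on S (\<lambda>x. g (f x))"
proof -
  obtain C :: "'b set" where C: "finite C" "span C = UNIV" "pairwise orthogonal C"
    using fd basis_orthogonal by metis
  define F where "F = {\<lambda>x. c x *\<^sub>R g (f x) |(c :: 'a \<Rightarrow> real) (g :: 'b \<Rightarrow> 'c). smooth_on S c \<and> smooth_on T g}"
  have der: "((\<lambda>x. c x *\<^sub>R g (f x)) has_derivative
      (\<lambda>v. frechet_derivative c (at x) v *\<^sub>R g (f x) +
        c x *\<^sub>R frechet_derivative g (at (f x)) (frechet_derivative f (at x) v))) (at x)"
    if "smooth_on S c" "smooth_on T g" "x \<in> S" for x and c :: "'a \<Rightarrow> real" and g :: "'b \<Rightarrow> 'c"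
  proof -
    have "f x \<in> T" using fST \<open>x \<in> S\<close> by auto
    have "((\<lambda>x. g (f x)) has_derivative
        (\<lambda>v. frechet_derivative g (at (f x)) (frechet_derivative f (at x) v))) (at x)"
      using diff_chain_at[OF smooth_on_has_derivative[OF f \<open>x \<in> S\<close>]
          smooth_on_has_derivative[OF that(2) \<open>f x \<in> T\<close>]] by (simp add: o_def)
    from has_derivative_scaleR[OF smooth_on_has_derivative[OF that(1,3)] this] show ?thesis
      by (simp add: add.commute)
  qed
  \<comment> \<open>The factor \<open>1\<close> only brings \<open>g (f x)\<close> into the shape of
    the family.\<close>
  have "smooth_on S (\<lambda>x. 1 *\<^sub>R g (f x))"
  proof (rule smooth_on_coinduct[where F = F])
    show "(\<lambda>x. 1 *\<^sub>R g (f x)) \<in> F"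
      unfolding F_def using g smooth_on_const[OF S, of 1]
      by (intro CollectI exI[of _ "\<lambda>x. 1"] exI[of _ g]) auto
  next
    fix h x assume "h \<in> F" "x \<in> S"
    then show "h differentiable (at x)"
      unfolding F_def differentiable_def using der by blast
  next
    fix h v assume "h \<in> F"
    then obtain c g where h: "h = (\<lambda>x. c x *\<^sub>R g (f x))" and c: "smooth_on S c"
      and g: "smooth_on T g" unfolding F_def by auto
    define k where "k = (\<lambda>x. frechet_derivative c (at x) v *\<^sub>R g (f x) +
      (\<Sum>b\<in>C. (c x * (frechet_derivative f (at x) v \<bullet> b / (b \<bullet> b))) *\<^sub>R
        frechet_derivative g (at (f x)) b))"
    have "k \<in> additive_closure F"
      unfolding k_def
    proof (intro additive_closure.add additive_closure_sum)
      show "(\<lambda>x. frechet_derivative c (at x) v *\<^sub>R g (f x)) \<in> additive_closure F"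
        using smooth_on_frechet_derivative[OF c, of v] g
        by (intro additive_closure.base, unfold F_def, intro CollectI
            exI[of _ "\<lambda>x. frechet_derivative c (at x) v"] exI[of _ g] conjI refl)
    next
      fix b
      have "smooth_on S (\<lambda>x. c x * (frechet_derivative f (at x) v \<bullet> b / (b \<bullet> b)))"
        by (intro smooth_on_mult S c smooth_on_bounded_linear[OF S smooth_on_frechet_derivative[OF f],
              where L = "\<lambda>y. y \<bullet> b / (b \<bullet> b)"]
              bounded_linear_compose[OF bounded_linear_divide bounded_linear_inner_left])
      then show "(\<lambda>x. (c x * (frechet_derivative f (at x) v \<bullet> b / (b \<bullet> b))) *\<^sub>R
          frechet_derivative g (at (f x)) b) \<in> additive_closure F"
        using smooth_on_frechet_derivative[OF g, of b]
        by (intro additive_closure.base, unfold F_def, intro CollectI conjI refl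
            exI[of _ "\<lambda>x. c x * (frechet_derivative f (at x) v \<bullet> b / (b \<bullet> b))"]
            exI[of _ "\<lambda>y. frechet_derivative g (at y) b"])
    qed
    moreover have "frechet_derivative h (at x) v = k x" if "x \<in> S" for x
    proof -
      let ?w = "frechet_derivative f (at x) v"
      have "f x \<in> T" using fST \<open>x \<in> S\<close> by auto
      interpret D: linear "frechet_derivative g (at (f x))"
        using smooth_on_has_derivative[OF g \<open>f x \<in> T\<close>] has_derivative_linear by blast
      have "frechet_derivative g (at (f x)) ?w =
          frechet_derivative g (at (f x)) (\<Sum>b\<in>C. (?w \<bullet> b / (b \<bullet> b)) *\<^sub>R b)"
        using orthogonal_expansion[OF C, of ?w] by simp
      also have "\<dots> = (\<Sum>b\<in>C. (?w \<bullet> b / (b \<bullet> b)) *\<^sub>R frechet_derivative g (at (f x)) b)"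
        by (simp add: D.sum D.scale)
      finally show ?thesis
        unfolding h k_def using frechet_derivativeI[OF der[OF c g \<open>x \<in> S\<close>]]
        by (simp add: scaleR_sum_right)
    qed
    ultimately show "\<exists>k\<in>additive_closure F. \<forall>x\<in>S. frechet_derivative h (at x) v = k x"
      by blast
  qed (rule S)
  then show ?thesis by simp
qed

lemma smooth_on_exp: "smooth_on UNIV (exp :: complex \<Rightarrow> complex)"
proof -
  have der: "((\<lambda>z. c * exp z) has_derivative (\<lambda>v. c * (v * exp x))) (at x)" for c x :: complex
    by (auto intro!: derivative_eq_intros)
  have "smooth_on UNIV (\<lambda>z :: complex. 1 * exp z)"
  proof (rule smooth_on_coinduct[where F = "range (\<lambda>c z. c * exp z)"])
    show "(\<lambda>z :: complex. 1 * exp z) \<in> range (\<lambda>c z. c * exp z)" by (rule rangeI)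
  next
    fix h :: "complex \<Rightarrow> complex" and v :: complex
    assume "h \<in> range (\<lambda>c z. c * exp z)"
    then obtain c where h: "h = (\<lambda>z. c * exp z)" by auto
    show "\<exists>k\<in>additive_closure (range (\<lambda>c z. c * exp z)). \<forall>x\<in>UNIV. frechet_derivative h (at x) v = k x"
      unfolding h
      by (intro bexI[OF _ additive_closure.base[OF rangeI[of _ "c * v"]]])
        (simp add: frechet_derivativeI[OF der])
  qed (auto intro!: differentiableI[OF der])
  then show ?thesis by simp
qed

text \<open>Differentiating a slice along \<open>v\<close> gives the slice of the derivative of
  \<open>H\<close> along \<open>(v, 0)\<close>, so slices form an invariant family. Treating this as
  a composition would call for a finite spanning set of the product space.\<close>

lemma smooth_on_slice:
  assumes S: "open S" and T: "open T" "S \<times> {b} \<subseteq> T" and H: "smooth_on T H"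
  shows "smooth_on S (\<lambda>a. H (a, b))"
proof (rule smooth_on_coinduct[where F = "{\<lambda>a. H (a, b) |H. smooth_on T H}"])
  have der: "((\<lambda>a. H (a, b)) has_derivative (\<lambda>v. frechet_derivative H (at (a, b)) (v, 0))) (at a)"
    if "smooth_on T H" "a \<in> S" for H :: "_ \<Rightarrow> 'c" and a
  proof -
    have "((\<lambda>a. (a, b)) has_derivative (\<lambda>v. (v, 0))) (at a)"
      by (auto intro!: derivative_eq_intros)
    from diff_chain_at[OF this smooth_on_has_derivative[OF that(1)]] that(2) T(2)
    show ?thesis by (auto simp: o_def)
  qed
  show "h differentiable (at a)" if "h \<in> {\<lambda>a. H (a, b) |H :: _ \<Rightarrow> 'c. smooth_on T H}" "a \<in> S" for h a
    using that der by (auto simp: differentiable_def)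
  show "\<exists>k\<in>additive_closure {\<lambda>a. H (a, b) |H. smooth_on T H}.
      \<forall>a\<in>S. frechet_derivative h (at a) v = k a"
    if "h \<in> {\<lambda>a. H (a, b) |H :: _ \<Rightarrow> 'c. smooth_on T H}" for h v
  proof -
    obtain H :: "_ \<Rightarrow> 'c" where h: "h = (\<lambda>a. H (a, b))" and H: "smooth_on T H" using \<open>h \<in> _\<close> by auto
    show ?thesis
      unfolding h
      by (intro bexI[OF _ additive_closure.base])
        (use smooth_on_frechet_derivative[OF H, of "(v, 0)"] frechet_derivativeI[OF der[OF H]] in auto)
  qed
qed (use assms in auto)

section \<open>Bounds for iterated derivatives of a product\<close>

lemma iter_deriv_add:
  assumes "open S" "smooth_on S f" "smooth_on S g" "x \<in> S"
  shows "iter_deriv vs (\<lambda>x. f x + g x) x = iter_deriv vs f x + iter_deriv vs g x"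
  using assms(4)
proof (induction vs arbitrary: x)
  case (Cons v vs)
  have "frechet_derivative (iter_deriv vs (\<lambda>x. f x + g x)) (at x) =
      frechet_derivative (\<lambda>x. iter_deriv vs f x + iter_deriv vs g x) (at x)"
    using Cons by (intro frechet_derivative_cong_open[OF assms(1)])
  with frechet_derivativeI[OF has_derivative_add[OF
        assms(2,3)[THEN smooth_on_iter_deriv, THEN smooth_on_has_derivative, OF Cons.prems]]]
  show ?case by simp
qed auto

lemma smooth_on_iter_deriv_bdd_above:
  assumes "smooth_on S f" "K \<subseteq> S" "compact K"
  shows "bdd_above ((\<lambda>y. norm (iter_deriv vs f y)) ` K)"
proof -
  have "continuous_on K (iter_deriv vs f)"
    using smooth_on_differentiable[OF smooth_on_iter_deriv[OF assms(1)]] assms(2)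
    by (intro continuous_at_imp_continuous_on) (blast intro: differentiable_imp_continuous_within)
  then show ?thesis
    using assms(3) by (intro bounded_imp_bdd_above compact_imp_bounded compact_continuous_image
        continuous_on_norm)
qed

text \<open>\<open>C\<close> and \<open>ws\<close> are chosen before \<open>g\<close>; this
  uniformity is what continuity of multiplication requires. The induction removes the last letter
  because it is the innermost derivative: the product rule is applied first, and the remaining word
  acts on two products to which the induction hypothesis applies. Removing the outermost derivative
  would mean differentiating an inequality.\<close>

lemma Leibniz_bound:
  fixes h :: "'a::real_normed_vector \<Rightarrow> 'b::real_normed_algebra"
  assumes "open S" "K \<subseteq> S" "compact K" "smooth_on S h"
  shows "\<exists>C ws. 0 \<le> C \<and> (\<forall>g. smooth_on S g \<longrightarrow> (\<forall>y\<in>K.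
    norm (iter_deriv vs (\<lambda>x. h x * g x) y) \<le> C * (\<Sum>w\<leftarrow>ws. norm (iter_deriv w g y))))"
  using assms(4)
proof (induction vs arbitrary: h rule: rev_induct)
  case Nil
  from smooth_on_iter_deriv_bdd_above[OF Nil assms(2,3), of "[]"]
  obtain C where C: "\<And>y. y \<in> K \<Longrightarrow> norm (h y) \<le> C"
    by (auto simp: bdd_above_def)
  have "norm (h y * g y) \<le> \<bar>C\<bar> * norm (g y)" if "y \<in> K" for y g
    using C[OF that] norm_mult_ineq[of "h y" "g y"] mult_right_mono[of "norm (h y)" "\<bar>C\<bar>" "norm (g y)"]
    by force
  then show ?case
    by (intro exI[of _ "\<bar>C\<bar>"] exI[of _ "[[]]"]) auto
next
  case (snoc v vs)
  obtain C1 ws1 where 1: "0 \<le> C1" "\<And>g y. smooth_on S g \<Longrightarrow> y \<in> K \<Longrightarrow>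
      norm (iter_deriv vs (\<lambda>x. frechet_derivative h (at x) v * g x) y)
        \<le> C1 * (\<Sum>w\<leftarrow>ws1. norm (iter_deriv w g y))"
    using snoc.IH[OF smooth_on_frechet_derivative[OF snoc.prems]] by blast
  obtain C2 ws2 where 2: "0 \<le> C2" "\<And>g y. smooth_on S g \<Longrightarrow> y \<in> K \<Longrightarrow>
      norm (iter_deriv vs (\<lambda>x. h x * g x) y) \<le> C2 * (\<Sum>w\<leftarrow>ws2. norm (iter_deriv w g y))"
    using snoc.IH[OF snoc.prems] by blast
  \<comment> \<open>The second product contains the derivative of \<open>g\<close> along
    \<open>v\<close>, so each of its words receives \<open>v\<close> as innermost direction.\<close>
  let ?ws = "ws1 @ map (\<lambda>w. w @ [v]) ws2"
  have "norm (iter_deriv (vs @ [v]) (\<lambda>x. h x * g x) y)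
      \<le> (C1 + C2) * (\<Sum>w\<leftarrow>?ws. norm (iter_deriv w g y))"
    if g: "smooth_on S g" and y: "y \<in> K" for g y
  proof -
    let ?h' = "\<lambda>x. frechet_derivative h (at x) v" and ?g' = "\<lambda>x. frechet_derivative g (at x) v"
    let ?s1 = "\<Sum>w\<leftarrow>ws1. norm (iter_deriv w g y)" and ?s2 = "\<Sum>w\<leftarrow>ws2. norm (iter_deriv w ?g' y)"
    have g': "smooth_on S ?g'" by (rule smooth_on_frechet_derivative[OF g])
    have s2: "?s2 = (\<Sum>w\<leftarrow>map (\<lambda>w. w @ [v]) ws2. norm (iter_deriv w g y))"
      by (simp add: iter_deriv_append o_def)
    have "y \<in> S" using y assms(2) by auto
    have "iter_deriv (vs @ [v]) (\<lambda>x. h x * g x) y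
        = iter_deriv vs (\<lambda>x. frechet_derivative (\<lambda>x. h x * g x) (at x) v) y"
      by (simp add: iter_deriv_append)
    also have "\<dots> = iter_deriv vs (\<lambda>x. ?h' x * g x + h x * ?g' x) y"
      using frechet_derivativeI[OF smooth_on_bilinear_has_derivative[OF bounded_bilinear_mult snoc.prems g]]
      by (intro iter_deriv_cong_open[OF assms(1) _ \<open>y \<in> S\<close>]) simp
    also have "\<dots> = iter_deriv vs (\<lambda>x. ?h' x * g x) y + iter_deriv vs (\<lambda>x. h x * ?g' x) y"
      using assms(1) snoc.prems g \<open>y \<in> S\<close>
      by (intro iter_deriv_add[OF assms(1)] smooth_on_mult smooth_on_frechet_derivative)
    also have "norm \<dots> \<le> C1 * ?s1 + C2 * ?s2"
      by (intro norm_triangle_le add_mono 1 2 g g' y)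
    also have "\<dots> \<le> (C1 + C2) * (?s1 + ?s2)"
    proof -
      have "0 \<le> ?s1" "0 \<le> ?s2" by (auto intro!: sum_list_nonneg)
      with 1(1) 2(1) have "0 \<le> C1 * ?s2" "0 \<le> C2 * ?s1" by simp_all
      then show ?thesis by (simp add: algebra_simps)
    qed
    finally show ?thesis by (simp add: s2)
  qed
  then show ?case
    using 1(1) 2(1) by (intro exI[of _ "C1 + C2"] exI[of _ ?ws]) auto
qed

section \<open>Smooth functions and the left-invariant vector field\<close>

lemma smooth_atlasD:
  assumes "smooth_atlas A" "(U, \<phi>) \<in> A"
  shows "open U" "open (\<phi> ` U)" "continuous_on U \<phi>" "continuous_on (\<phi> ` U) (inv_into U \<phi>)"
    "\<And>x. x \<in> U \<Longrightarrow> inv_into U \<phi> (\<phi> x) = x"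
proof -
  have *: "open U \<and> open (\<phi> ` U) \<and> homeomorphism U (\<phi> ` U) \<phi> (inv_into U \<phi>)"
    using assms unfolding smooth_atlas_def by blast
  then show "open U" "open (\<phi> ` U)" by auto
  from * show "continuous_on U \<phi>" "continuous_on (\<phi> ` U) (inv_into U \<phi>)"
    "\<And>x. x \<in> U \<Longrightarrow> inv_into U \<phi> (\<phi> x) = x"
    unfolding homeomorphism_def by auto
qed

lemma smooth_atlas_cover:
  assumes "smooth_atlas A"
  obtains U \<phi> where "(U, \<phi>) \<in> A" "x \<in> U"
proof -
  have "x \<in> (\<Union>(U, \<phi>)\<in>A. U)" using assms unfolding smooth_atlas_def by simp
  then show ?thesis using that by auto
qed

lemma smooth_functionsD:
  "f \<in> smooth_functions A \<Longrightarrow> (U, \<phi>) \<in> A \<Longrightarrow> smooth_on (\<phi> ` U) (\<lambda>y. f (inv_into U \<phi> y))"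
  unfolding smooth_functions_def o_def by auto

lemma smooth_functionsI:
  "(\<And>U \<phi>. (U, \<phi>) \<in> A \<Longrightarrow> smooth_on (\<phi> ` U) (\<lambda>y. f (inv_into U \<phi> y))) \<Longrightarrow> f \<in> smooth_functions A"
  unfolding smooth_functions_def o_def by auto

lemma Cinf_const: "smooth_atlas A \<Longrightarrow> (\<lambda>x. c) \<in> Cinf A"
  by (rule smooth_functionsI) (intro smooth_on_const smooth_atlasD(2))

lemma Cinf_add:
  "smooth_atlas A \<Longrightarrow> f \<in> Cinf A \<Longrightarrow> g \<in> Cinf A \<Longrightarrow> (\<lambda>x. f x + g x) \<in> Cinf A"
  by (rule smooth_functionsI) (intro smooth_on_add smooth_atlasD(2) smooth_functionsD)

lemma Cinf_mult:
  "smooth_atlas A \<Longrightarrow> f \<in> Cinf A \<Longrightarrow> g \<in> Cinf A \<Longrightarrow> (\<lambda>x. f x * g x) \<in> Cinf A"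
  by (rule smooth_functionsI) (intro smooth_on_mult smooth_atlasD(2) smooth_functionsD)

lemma Cinf_uminus: "smooth_atlas A \<Longrightarrow> f \<in> Cinf A \<Longrightarrow> (\<lambda>x. - f x) \<in> Cinf A"
  using Cinf_mult[OF _ Cinf_const, of A f "-1"] by simp

lemma Cinf_diff:
  "smooth_atlas A \<Longrightarrow> f \<in> Cinf A \<Longrightarrow> g \<in> Cinf A \<Longrightarrow> (\<lambda>x. f x - g x) \<in> Cinf A"
  using Cinf_add[OF _ _ Cinf_uminus, of A f g] by simp

lemma Cinf_exp: "smooth_atlas A \<Longrightarrow> f \<in> Cinf A \<Longrightarrow> (\<lambda>x. exp (f x)) \<in> Cinf A"
  by (rule smooth_functionsI) (intro smooth_on_compose[OF _ _ smooth_on_exp] smooth_atlasD(2) smooth_functionsD,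
      auto intro!: exI[of _ Basis])

section \<open>The flow of \<open>X\<close> and differentiation along it\<close>

locale lie_group_flow =
  fixes gmul :: "'g::{t2_space,second_countable_topology} \<Rightarrow> 'g \<Rightarrow> 'g"
    and e :: 'g and inver :: "'g \<Rightarrow> 'g"
    and A :: "('g, 'e::real_inner) atlas"
    and expG :: "(('g \<Rightarrow> real) \<Rightarrow> real) \<Rightarrow> 'g"
    and X :: "('g \<Rightarrow> real) \<Rightarrow> real"
  assumes lie: "compact_lie_group gmul e inver A"
    and expG: "exponential_map gmul e A expG"
    and X: "X \<in> lie_algebra e A"
begin

abbreviation "XF \<equiv> vector_field gmul A expG X"

abbreviation \<gamma> :: "real \<Rightarrow> 'g" where "\<gamma> t \<equiv> expG (lie_scale A t X)"

lemma atlas: "smooth_atlas A"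
  using lie unfolding compact_lie_group_def by blast

lemma mult_e: "gmul x e = x"
proof -
  interpret Groups.group gmul e inver using lie unfolding compact_lie_group_def by blast
  show ?thesis by simp
qed

text \<open>From \<open>0 + 0 = 0\<close>, the one-parameter subgroup is idempotent at time 0;
  cancellation in the group gives \<open>e\<close>.\<close>

lemma flow_0: "\<gamma> 0 = e"
proof -
  interpret Groups.group gmul e inver using lie unfolding compact_lie_group_def by blast
  have "gmul (\<gamma> 0) (\<gamma> 0) = \<gamma> 0"
    using expG X unfolding exponential_map_def by (metis add_0)
  then show ?thesis by (metis left_cancel mult_e)
qed

lemma open_mult_domain:
  assumes "(U, \<phi>) \<in> A" "(V, \<psi>) \<in> A" "(W, \<eta>) \<in> A"
  shows "open {(a, b). a \<in> \<phi> ` U \<and> b \<in> \<psi> ` V \<and> gmul (inv_into U \<phi> a) (inv_into V \<psi> b) \<in> W}"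
proof -
  note ch = smooth_atlasD[OF atlas]
  have "continuous_on (\<phi> ` U \<times> \<psi> ` V) (\<lambda>p. (inv_into U \<phi> (fst p), inv_into V \<psi> (snd p)))"
    by (intro continuous_on_Pair continuous_on_compose2[OF ch(4)[OF assms(1)]]
        continuous_on_compose2[OF ch(4)[OF assms(2)]] continuous_on_fst continuous_on_snd) auto
  moreover have "continuous_on UNIV (\<lambda>(x, y). gmul x y)"
    using lie unfolding compact_lie_group_def smooth_mult_def by blast
  ultimately have "continuous_on (\<phi> ` U \<times> \<psi> ` V)
      (\<lambda>p. (\<lambda>(x, y). gmul x y) (inv_into U \<phi> (fst p), inv_into V \<psi> (snd p)))"
    by (intro continuous_on_compose2[where f = "\<lambda>p. (inv_into U \<phi> (fst p), inv_into V \<psi> (snd p))"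
          and g = "\<lambda>(x, y). gmul x y" and t = UNIV]) auto
  from continuous_open_preimage[OF this open_Times[OF ch(2) ch(2)] ch(1)] assms
  have "open ((\<phi> ` U \<times> \<psi> ` V) \<inter>
      (\<lambda>p. (\<lambda>(x, y). gmul x y) (inv_into U \<phi> (fst p), inv_into V \<psi> (snd p))) -` W)" by blast
  also have "(\<phi> ` U \<times> \<psi> ` V) \<inter>
      (\<lambda>p. (\<lambda>(x, y). gmul x y) (inv_into U \<phi> (fst p), inv_into V \<psi> (snd p))) -` W =
      {(a, b). a \<in> \<phi> ` U \<and> b \<in> \<psi> ` V \<and> gmul (inv_into U \<phi> a) (inv_into V \<psi> b) \<in> W}"
    by auto
  finally show ?thesis .
qed

text \<open>Inserting the chart \<open>\<eta>\<close> around the product splits the map into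
  multiplication in charts followed by \<open>f\<close> in the chart \<open>\<eta>\<close>, both
  smooth by definition.\<close>

lemma smooth_on_mult_charts:
  assumes ch: "(U, \<phi>) \<in> A" "(V, \<psi>) \<in> A" "(W, \<eta>) \<in> A" and f: "f \<in> Cinf A"
  shows "smooth_on {(a, b). a \<in> \<phi> ` U \<and> b \<in> \<psi> ` V \<and> gmul (inv_into U \<phi> a) (inv_into V \<psi> b) \<in> W}
    (\<lambda>(a, b). f (gmul (inv_into U \<phi> a) (inv_into V \<psi> b)))" (is "smooth_on ?T ?H")
proof (rule smooth_on_cong)
  let ?m = "\<lambda>(a, b). \<eta> (gmul (inv_into U \<phi> a) (inv_into V \<psi> b))"
  show "open ?T" by (rule open_mult_domain[OF ch])
  have m: "smooth_on ?T ?m"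
    using lie ch unfolding compact_lie_group_def smooth_mult_def by blast
  show "smooth_on ?T (\<lambda>p. f (inv_into W \<eta> (?m p)))"
  proof (rule smooth_on_compose[OF \<open>open ?T\<close> m smooth_functionsD[OF f ch(3)]])
    show "\<exists>B :: 'e set. finite B \<and> span B = UNIV"
      using atlas unfolding smooth_atlas_def by blast
  qed auto
  show "?H p = f (inv_into W \<eta> (?m p))" if "p \<in> ?T" for p
    using that smooth_atlasD(5)[OF atlas ch(3)] by auto
qed

text \<open>The chain rule along \<open>t \<mapsto> (a, \<psi> (\<gamma> t))\<close>. The velocity
  of \<open>\<psi> \<circ> \<gamma>\<close> does not depend on \<open>a\<close>, so the right-hand
  side depends on \<open>a\<close> only through a partial derivative of a smooth function.\<close>

lemma flow_derivative_in_charts: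
  assumes ch: "(U, \<phi>) \<in> A" "(V, \<psi>) \<in> A" "(W, \<eta>) \<in> A" and f: "f \<in> Cinf A"
    and "a \<in> \<phi> ` U" "e \<in> V" "inv_into U \<phi> a \<in> W"
  shows "((\<lambda>t. f (gmul (inv_into U \<phi> a) (\<gamma> t))) has_vector_derivative
     frechet_derivative (\<lambda>(a, b). f (gmul (inv_into U \<phi> a) (inv_into V \<psi> b))) (at (a, \<psi> e))
       (0, frechet_derivative (\<psi> \<circ> \<gamma>) (at 0) 1)) (at 0)"
    (is "(_ has_vector_derivative frechet_derivative ?H _ (0, ?w)) _")
proof -
  let ?D = "frechet_derivative ?H (at (a, \<psi> e))"
  have curve: "smooth_curve A \<gamma>"
    using expG X unfolding exponential_map_def by blast
  then have "smooth_on (\<gamma> -` V) (\<psi> \<circ> \<gamma>)" "continuous_on UNIV \<gamma>"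
    using ch(2) unfolding smooth_curve_def by auto
  have "0 \<in> \<gamma> -` V" using flow_0 \<open>e \<in> V\<close> by simp
  have op: "open (\<gamma> -` V)"
    using smooth_atlasD(1)[OF atlas ch(2)] \<open>continuous_on UNIV \<gamma>\<close> open_vimage by blast
  have d\<gamma>: "((\<psi> \<circ> \<gamma>) has_derivative frechet_derivative (\<psi> \<circ> \<gamma>) (at 0)) (at 0)"
    by (rule smooth_on_has_derivative[OF \<open>smooth_on (\<gamma> -` V) (\<psi> \<circ> \<gamma>)\<close> \<open>0 \<in> \<gamma> -` V\<close>])
  define w where "w = ?w"
  have w: "frechet_derivative (\<psi> \<circ> \<gamma>) (at 0) s = s *\<^sub>R w" for s
    using linear_scale[OF has_derivative_linear[OF d\<gamma>], of s 1] by (simp add: w_def)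
  have "(a, \<psi> e) \<in> {(a, b). a \<in> \<phi> ` U \<and> b \<in> \<psi> ` V \<and> gmul (inv_into U \<phi> a) (inv_into V \<psi> b) \<in> W}"
    using assms smooth_atlasD(5)[OF atlas ch(2)] mult_e by auto
  from smooth_on_has_derivative[OF smooth_on_mult_charts[OF ch f] this]
  have dH: "(?H has_derivative ?D) (at (a, (\<psi> \<circ> \<gamma>) 0))" by (simp add: flow_0)
  have "((\<lambda>t. (a, (\<psi> \<circ> \<gamma>) t)) has_derivative (\<lambda>s. (0, s *\<^sub>R w))) (at 0)"
    using has_derivative_Pair[OF has_derivative_const[of a] d\<gamma>] unfolding w .
  from diff_chain_at[OF this dH]
  have "((\<lambda>t. ?H (a, (\<psi> \<circ> \<gamma>) t)) has_derivative (\<lambda>s. ?D (0, s *\<^sub>R w))) (at 0)"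
    by (simp add: o_def)
  also have "(\<lambda>s. ?D (0, s *\<^sub>R w)) = (\<lambda>s. s *\<^sub>R ?D (0, w))"
    using linear_scale[OF has_derivative_linear[OF dH], of _ "(0, w)"] by (simp add: scaleR_prod_def)
  finally have "((\<lambda>t. ?H (a, (\<psi> \<circ> \<gamma>) t)) has_vector_derivative ?D (0, w)) (at 0)"
    by (simp add: has_vector_derivative_def)
  then show ?thesis
    unfolding w_def
    \<comment> \<open>The coordinates \<open>\<psi>\<close> undo \<open>inv_into V \<psi>\<close>
      only while \<open>\<gamma> t\<close> stays in \<open>V\<close>, that is, on an open set of
      times around 0.\<close>
    by (rule has_vector_derivative_transform_within_open[OF _ op \<open>0 \<in> \<gamma> -` V\<close>])
      (use smooth_atlasD(5)[OF atlas ch(2)] in auto)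
qed

text \<open>\<open>vector_derivative\<close> is total, so the content is that the derivative exists.
  One chart serves as source and target because \<open>x e = x\<close>.\<close>

lemma flow_has_vector_derivative:
  assumes "f \<in> Cinf A"
  shows "((\<lambda>t. f (gmul x (\<gamma> t))) has_vector_derivative XF f x) (at 0)"
proof -
  obtain U \<phi> where U: "(U, \<phi>) \<in> A" "x \<in> U" using smooth_atlas_cover[OF atlas] .
  obtain V \<psi> where V: "(V, \<psi>) \<in> A" "e \<in> V" using smooth_atlas_cover[OF atlas] .
  have "inv_into U \<phi> (\<phi> x) = x" by (rule smooth_atlasD(5)[OF atlas U])
  with flow_derivative_in_charts[OF U(1) V(1) U(1) assms imageI[OF U(2)] V(2)] U(2)
  have "((\<lambda>t. f (gmul x (\<gamma> t))) has_vector_derivative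
     frechet_derivative (\<lambda>(a, b). f (gmul (inv_into U \<phi> a) (inv_into V \<psi> b))) (at (\<phi> x, \<psi> e))
       (0, frechet_derivative (\<psi> \<circ> \<gamma>) (at 0) 1)) (at 0)" by simp
  then show ?thesis
    unfolding vector_field_def by (simp only: vector_derivative_at)
qed

lemma vector_fieldI:
  "((\<lambda>t. f (gmul x (\<gamma> t))) has_vector_derivative d) (at 0) \<Longrightarrow> XF f x = d"
  unfolding vector_field_def by (rule vector_derivative_at)

lemma Cinf_vector_field:
  assumes f: "f \<in> Cinf A"
  shows "XF f \<in> Cinf A"
proof (rule smooth_functionsI, rule smooth_on_local)
  fix U \<phi> a0 assume U: "(U, \<phi>) \<in> A" and a0: "a0 \<in> \<phi> ` U"
  obtain W \<eta> where W: "(W, \<eta>) \<in> A" "inv_into U \<phi> a0 \<in> W" using smooth_atlas_cover[OF atlas] .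
  obtain V \<psi> where V: "(V, \<psi>) \<in> A" "e \<in> V" using smooth_atlas_cover[OF atlas] .
  let ?T = "{(a, b). a \<in> \<phi> ` U \<and> b \<in> \<psi> ` V \<and> gmul (inv_into U \<phi> a) (inv_into V \<psi> b) \<in> W}"
  let ?H = "\<lambda>(a, b). f (gmul (inv_into U \<phi> a) (inv_into V \<psi> b))"
  \<comment> \<open>The slice at the identity; since \<open>x e = x\<close>, it is the set of
    coordinates of \<open>U \<inter> W\<close>. It depends on \<open>a0\<close> through
    \<open>W\<close>, so smoothness is obtained locally.\<close>
  define S where "S = (\<lambda>a. (a, \<psi> e)) -` ?T"
  have S: "open S"
    unfolding S_def by (intro open_vimage open_mult_domain[OF U V(1) W(1)] continuous_intros)
  have S_iff: "a \<in> S \<longleftrightarrow> a \<in> \<phi> ` U \<and> inv_into U \<phi> a \<in> W" for a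
    unfolding S_def using V(2) smooth_atlasD(5)[OF atlas V(1)] mult_e by auto
  have "smooth_on S (\<lambda>a. frechet_derivative ?H (at (a, \<psi> e)) (0, frechet_derivative (\<psi> \<circ> \<gamma>) (at 0) 1))"
    by (rule smooth_on_slice[OF S open_mult_domain[OF U V(1) W(1)] _
          smooth_on_frechet_derivative[OF smooth_on_mult_charts[OF U V(1) W(1) f]]])
      (auto simp: S_def)
  then have "smooth_on S (\<lambda>a. XF f (inv_into U \<phi> a))"
    by (rule smooth_on_cong[OF S, rotated])
      (use vector_fieldI[OF flow_derivative_in_charts[OF U V(1) W(1) f _ V(2)]] S_iff in blast)
  then show "\<exists>S. a0 \<in> S \<and> smooth_on S (\<lambda>a. XF f (inv_into U \<phi> a))"
    using S_iff a0 W(2) by blast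
qed

lemma vector_field_mult:
  assumes "f \<in> Cinf A" "g \<in> Cinf A"
  shows "XF (\<lambda>x. f x * g x) x = XF f x * g x + f x * XF g x"
  using has_vector_derivative_mult[OF assms[THEN flow_has_vector_derivative]]
  by (intro vector_fieldI) (simp add: flow_0 mult_e add.commute)

lemma vector_field_uminus: "f \<in> Cinf A \<Longrightarrow> XF (\<lambda>x. - f x) x = - XF f x"
  by (intro vector_fieldI has_vector_derivative_minus flow_has_vector_derivative)

lemma vector_field_exp:
  assumes "f \<in> Cinf A"
  shows "XF (\<lambda>x. exp (f x)) x = XF f x * exp (f x)"
  using field_vector_diff_chain_at[OF flow_has_vector_derivative[OF assms] DERIV_exp]
  by (intro vector_fieldI) (simp add: flow_0 mult_e o_def)

end

section \<open>Multiplication of distributions by smooth functions\<close>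

text \<open>A real supremum dominates its members only for bounded families; boundedness comes from
  continuity of the derivative on the compact set \<open>K\<close>.\<close>

lemma norm_iter_deriv_le_seminorm:
  assumes "(U, \<phi>) \<in> A" "K \<subseteq> \<phi> ` U" "compact K" "f \<in> Cinf A" "y \<in> K"
  shows "cmod (iter_deriv vs (\<lambda>y. f (inv_into U \<phi> y)) y) \<le> Cinf_seminorm (U, \<phi>) K vs f"
  unfolding Cinf_seminorm_def prod.case o_def
  by (rule cSUP_upper[OF assms(5)
        smooth_on_iter_deriv_bdd_above[OF smooth_functionsD[OF assms(4,1)] assms(2,3)]])

lemma seminorm_le:
  assumes "K \<noteq> {}" "\<And>y. y \<in> K \<Longrightarrow> cmod (iter_deriv vs (\<lambda>y. f (inv_into U \<phi> y)) y) \<le> B"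
  shows "Cinf_seminorm (U, \<phi>) K vs f \<le> B"
  unfolding Cinf_seminorm_def prod.case o_def using assms by (rule cSUP_least)

lemma seminorm_zero: "K \<noteq> {} \<Longrightarrow> Cinf_seminorm (U, \<phi>) K vs (\<lambda>x. 0) = 0"
  by (simp add: Cinf_seminorm_def o_def iter_deriv_zero)

lemma seminorm_add:
  assumes A: "smooth_atlas A" and K: "(U, \<phi>) \<in> A" "K \<subseteq> \<phi> ` U" "compact K" "K \<noteq> {}"
    and fg: "f \<in> Cinf A" "g \<in> Cinf A"
  shows "Cinf_seminorm (U, \<phi>) K vs (\<lambda>x. f x + g x)
    \<le> Cinf_seminorm (U, \<phi>) K vs f + Cinf_seminorm (U, \<phi>) K vs g"
proof (rule seminorm_le[OF K(4)])
  fix y assume y: "y \<in> K"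
  then have "y \<in> \<phi> ` U" using K(2) by auto
  show "cmod (iter_deriv vs (\<lambda>y. f (inv_into U \<phi> y) + g (inv_into U \<phi> y)) y)
      \<le> Cinf_seminorm (U, \<phi>) K vs f + Cinf_seminorm (U, \<phi>) K vs g"
    unfolding iter_deriv_add[OF smooth_atlasD(2)[OF A K(1)] fg[THEN smooth_functionsD, OF K(1)] \<open>y \<in> \<phi> ` U\<close>]
    by (intro norm_triangle_le add_mono norm_iter_deriv_le_seminorm[OF K(1,2,3) _ y] fg)
qed

lemma seminorm_mult:
  assumes A: "smooth_atlas A" and K: "(U, \<phi>) \<in> A" "K \<subseteq> \<phi> ` U" "compact K" "K \<noteq> {}"
    and h: "h \<in> Cinf A"
  shows "\<exists>C ws. 0 \<le> C \<and> (\<forall>g\<in>Cinf A. Cinf_seminorm (U, \<phi>) K vs (\<lambda>x. h x * g x)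
    \<le> C * (\<Sum>w\<leftarrow>ws. Cinf_seminorm (U, \<phi>) K w g))"
proof -
  obtain C ws where C: "0 \<le> C" and bound: "\<And>g y. smooth_on (\<phi> ` U) g \<Longrightarrow> y \<in> K \<Longrightarrow>
      cmod (iter_deriv vs (\<lambda>y. h (inv_into U \<phi> y) * g y) y) \<le> C * (\<Sum>w\<leftarrow>ws. cmod (iter_deriv w g y))"
    using Leibniz_bound[OF smooth_atlasD(2)[OF A K(1)] K(2,3) smooth_functionsD[OF h K(1)], of vs]
    by blast
  have "Cinf_seminorm (U, \<phi>) K vs (\<lambda>x. h x * g x) \<le> C * (\<Sum>w\<leftarrow>ws. Cinf_seminorm (U, \<phi>) K w g)"
    if g: "g \<in> Cinf A" for g
  proof (rule seminorm_le[OF K(4)])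
    fix y assume y: "y \<in> K"
    show "cmod (iter_deriv vs (\<lambda>y. h (inv_into U \<phi> y) * g (inv_into U \<phi> y)) y)
        \<le> C * (\<Sum>w\<leftarrow>ws. Cinf_seminorm (U, \<phi>) K w g)"
      by (rule order_trans[OF bound[OF smooth_functionsD[OF g K(1)] y]])
        (intro mult_left_mono C sum_list_mono norm_iter_deriv_le_seminorm[OF K(1,2,3) g y])
  qed
  with C show ?thesis by blast
qed

lemma openin_seminorm_ball:
  assumes "(U, \<phi>) \<in> A" "K \<subseteq> \<phi> ` U" "compact K" "K \<noteq> {}" "f \<in> Cinf A" "\<epsilon> > 0"
  shows "openin (Cinf_topology A) {g \<in> Cinf A. Cinf_seminorm (U, \<phi>) K vs (\<lambda>x. g x - f x) < \<epsilon>}"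
  unfolding Cinf_topology_def using assms by (intro topology_generated_by_Basis) blast

lemma topspace_Cinf_topology:
  assumes "smooth_atlas A"
  shows "topspace (Cinf_topology A) = Cinf A"
proof
  show "topspace (Cinf_topology A) \<subseteq> Cinf A"
    unfolding Cinf_topology_def topology_generated_by_topspace by blast
  show "Cinf A \<subseteq> topspace (Cinf_topology A)"
  proof
    fix f assume f: "f \<in> Cinf A"
    \<comment> \<open>\<open>undefined\<close> is just some point of the group; a single point in a
      chart gives a compact set and thus a basic set containing \<open>f\<close>.\<close>
    obtain U \<phi> where U: "(U, \<phi>) \<in> A" "undefined \<in> U" using smooth_atlas_cover[OF assms] .
    have "openin (Cinf_topology A)
        {g \<in> Cinf A. Cinf_seminorm (U, \<phi>) {\<phi> undefined} [] (\<lambda>x. g x - f x) < 1}"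
      using U f by (intro openin_seminorm_ball) auto
    moreover have "f \<in> {g \<in> Cinf A. Cinf_seminorm (U, \<phi>) {\<phi> undefined} [] (\<lambda>x. g x - f x) < 1}"
      using f by (simp add: seminorm_zero)
    ultimately show "f \<in> topspace (Cinf_topology A)"
      using openin_subset by blast
  qed
qed

lemma openin_seminorm_balls:
  assumes A: "smooth_atlas A" and K: "(U, \<phi>) \<in> A" "K \<subseteq> \<phi> ` U" "compact K" "K \<noteq> {}"
    and f: "f \<in> Cinf A" and "\<delta> > 0"
  shows "openin (Cinf_topology A)
    {g \<in> Cinf A. \<forall>w\<in>set ws. Cinf_seminorm (U, \<phi>) K w (\<lambda>x. g x - f x) < \<delta>}"
proof (induction ws)
  case Nil
  then show ?case using openin_topspace[of "Cinf_topology A"] topspace_Cinf_topology[OF A] by simp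
next
  case (Cons w ws)
  have "{g \<in> Cinf A. \<forall>w\<in>set (w # ws). Cinf_seminorm (U, \<phi>) K w (\<lambda>x. g x - f x) < \<delta>} =
      {g \<in> Cinf A. Cinf_seminorm (U, \<phi>) K w (\<lambda>x. g x - f x) < \<delta>} \<inter>
      {g \<in> Cinf A. \<forall>w\<in>set ws. Cinf_seminorm (U, \<phi>) K w (\<lambda>x. g x - f x) < \<delta>}"
    by auto
  then show ?case
    using openin_Int[OF openin_seminorm_ball[OF K f \<open>\<delta> > 0\<close>] Cons] by simp
qed

lemma mult_op_in_Cinf: "smooth_atlas A \<Longrightarrow> h \<in> Cinf A \<Longrightarrow> f \<in> Cinf A \<Longrightarrow> mult_op h f \<in> Cinf A"
  unfolding mult_op_def by (rule Cinf_mult)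

text \<open>Preimages need checking only for the generating balls. These have arbitrary centres
  \<open>f\<close>, so around a point \<open>g0\<close> of the preimage one splits
  \<open>h g - f = h (g - g0) + (h g0 - f)\<close> and controls the first term by finitely many
  seminorms of \<open>g - g0\<close>.\<close>

lemma continuous_map_mult_op:
  assumes A: "smooth_atlas A" and h: "h \<in> Cinf A"
  shows "continuous_map (Cinf_topology A) (Cinf_topology A) (mult_op h)"
proof -
  let ?S = "{{g \<in> Cinf A. Cinf_seminorm (U, \<phi>) K vs (\<lambda>x. g x - f x) < \<epsilon>} | U \<phi> K vs f \<epsilon>.
        (U, \<phi>) \<in> A \<and> compact K \<and> K \<noteq> {} \<and> K \<subseteq> \<phi> ` U \<and> f \<in> Cinf A \<and> \<epsilon> > 0}"
  have top: "topspace (Cinf_topology A) = Cinf A" "\<Union> ?S = Cinf A"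
    using topspace_Cinf_topology[OF A] unfolding Cinf_topology_def topology_generated_by_topspace
    by auto
  have "continuous_map (Cinf_topology A) (topology_generated_by ?S) (mult_op h)"
    unfolding continuous_on_generated_topo_iff top
  proof (intro conjI allI impI)
    show "mult_op h ` Cinf A \<subseteq> Cinf A"
      using mult_op_in_Cinf[OF A h] by auto
  next
    fix W assume "W \<in> ?S"
    then obtain U \<phi> K vs f \<epsilon> where K: "(U, \<phi>) \<in> A" "K \<subseteq> \<phi> ` U" "compact K" "K \<noteq> {}"
      and f: "f \<in> Cinf A" and "\<epsilon> > 0"
      and W: "W = {g \<in> Cinf A. Cinf_seminorm (U, \<phi>) K vs (\<lambda>x. g x - f x) < \<epsilon>}"
      by blast
    obtain C ws where C: "0 \<le> C" and bound: "\<And>g. g \<in> Cinf A \<Longrightarrow>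
        Cinf_seminorm (U, \<phi>) K vs (\<lambda>x. h x * g x) \<le> C * (\<Sum>w\<leftarrow>ws. Cinf_seminorm (U, \<phi>) K w g)"
      using seminorm_mult[OF A K h] by blast
    show "openin (Cinf_topology A) (mult_op h -` W \<inter> Cinf A)"
    proof (subst openin_subopen, intro ballI)
      fix g0 assume "g0 \<in> mult_op h -` W \<inter> Cinf A"
      then have g0: "g0 \<in> Cinf A"
        and less: "Cinf_seminorm (U, \<phi>) K vs (\<lambda>x. h x * g0 x - f x) < \<epsilon>"
        by (auto simp: W mult_op_def)
      \<comment> \<open>\<open>\<epsilon>'\<close> is the room left in the ball at
        \<open>h g0\<close>. The \<open>+ 1\<close> in \<open>\<delta>\<close> keeps the denominator
        positive when \<open>C\<close> is 0 or \<open>ws\<close> is empty, and makes the later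
        estimate strict.\<close>
      define \<epsilon>' where "\<epsilon>' = \<epsilon> - Cinf_seminorm (U, \<phi>) K vs (\<lambda>x. h x * g0 x - f x)"
      define \<delta> where "\<delta> = \<epsilon>' / (C * length ws + 1)"
      have den: "C * length ws + 1 > 0" using C by (simp add: add_nonneg_pos)
      have "\<epsilon>' > 0" using less by (simp add: \<epsilon>'_def)
      then have "\<delta> > 0" using den by (simp add: \<delta>_def)
      have "\<delta> * (C * length ws + 1) = \<epsilon>'" using den by (simp add: \<delta>_def)
      then have small: "C * (length ws * \<delta>) < \<epsilon>'" using \<open>\<delta> > 0\<close> by (simp add: algebra_simps)
      let ?N = "{g \<in> Cinf A. \<forall>w\<in>set ws. Cinf_seminorm (U, \<phi>) K w (\<lambda>x. g x - g0 x) < \<delta>}"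
      have "?N \<subseteq> mult_op h -` W \<inter> Cinf A"
      proof safe
        fix g assume g: "g \<in> Cinf A"
          and near: "\<forall>w\<in>set ws. Cinf_seminorm (U, \<phi>) K w (\<lambda>x. g x - g0 x) < \<delta>"
        have "(\<lambda>x. h x * g x - f x) = (\<lambda>x. h x * (g x - g0 x) + (h x * g0 x - f x))"
          by (simp add: algebra_simps)
        then have "Cinf_seminorm (U, \<phi>) K vs (\<lambda>x. h x * g x - f x)
            \<le> Cinf_seminorm (U, \<phi>) K vs (\<lambda>x. h x * (g x - g0 x))
              + Cinf_seminorm (U, \<phi>) K vs (\<lambda>x. h x * g0 x - f x)"
          using seminorm_add[OF A K Cinf_mult[OF A h Cinf_diff[OF A g g0]]
              Cinf_diff[OF A Cinf_mult[OF A h g0] f]] by simp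
        also have "Cinf_seminorm (U, \<phi>) K vs (\<lambda>x. h x * (g x - g0 x))
            \<le> C * (\<Sum>w\<leftarrow>ws. Cinf_seminorm (U, \<phi>) K w (\<lambda>x. g x - g0 x))"
          by (rule bound[OF Cinf_diff[OF A g g0]])
        also have "(\<Sum>w\<leftarrow>ws. Cinf_seminorm (U, \<phi>) K w (\<lambda>x. g x - g0 x)) \<le> (\<Sum>w\<leftarrow>ws. \<delta>)"
          using near by (intro sum_list_mono) (simp add: less_imp_le)
        also have "(\<Sum>w\<leftarrow>ws. \<delta>) = length ws * \<delta>"
          by (simp add: sum_list_triv)
        also note small
        finally have "Cinf_seminorm (U, \<phi>) K vs (\<lambda>x. h x * g x - f x) < \<epsilon>"
          using C by (simp add: \<epsilon>'_def mult_left_mono)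
        then show "g \<in> mult_op h -` W"
          using Cinf_mult[OF A h g] by (simp add: W mult_op_def)
      qed
      moreover have "g0 \<in> ?N"
        using g0 K(4) \<open>\<delta> > 0\<close> by (simp add: seminorm_zero)
      ultimately show "\<exists>T. openin (Cinf_topology A) T \<and> g0 \<in> T \<and> T \<subseteq> mult_op h -` W \<inter> Cinf A"
        using openin_seminorm_balls[OF A K g0 \<open>\<delta> > 0\<close>] by blast
    qed
  qed
  then show ?thesis unfolding Cinf_topology_def .
qed

section \<open>Multiplication operators on distributions\<close>

lemma distributionsD:
  assumes "u \<in> distributions A"
  shows "u \<in> extensional (Cinf A)"
    "\<And>f g. f \<in> Cinf A \<Longrightarrow> g \<in> Cinf A \<Longrightarrow> u (\<lambda>x. f x + g x) = u f + u g"
    "\<And>c f. f \<in> Cinf A \<Longrightarrow> u (\<lambda>x. c * f x) = c * u f"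
    "continuous_map (Cinf_topology A) euclidean u"
  using assms unfolding distributions_def by auto

lemma mult_op_dist_in_distributions:
  assumes A: "smooth_atlas A" and h: "h \<in> Cinf A" and u: "u \<in> distributions A"
  shows "mult_op_dist A h u \<in> distributions A"
proof -
  have "continuous_map (Cinf_topology A) euclidean (mult_op_dist A h u)"
    by (rule continuous_map_eq[OF continuous_map_compose[OF continuous_map_mult_op[OF A h]
            distributionsD(4)[OF u]]])
      (simp add: topspace_Cinf_topology[OF A] mult_op_dist_def)
  moreover have "mult_op_dist A h u (\<lambda>x. f x + g x) = mult_op_dist A h u f + mult_op_dist A h u g"
    if "f \<in> Cinf A" "g \<in> Cinf A" for f g
    using that distributionsD(2)[OF u Cinf_mult[OF A h that(1)] Cinf_mult[OF A h that(2)]]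
    by (simp add: mult_op_dist_def mult_op_def Cinf_add[OF A] distrib_left)
  moreover have "mult_op_dist A h u (\<lambda>x. c * f x) = c * mult_op_dist A h u f"
    if "f \<in> Cinf A" for c f
    using that distributionsD(3)[OF u Cinf_mult[OF A h that], of c] Cinf_mult[OF A Cinf_const[OF A, of c] that]
    by (simp add: mult_op_dist_def mult_op_def mult.left_commute)
  ultimately show ?thesis
    unfolding distributions_def by (simp add: mult_op_dist_def)
qed

lemma mult_op_dist_dist_of:
  assumes A: "smooth_atlas A" and h: "h \<in> Cinf A"
  shows "mult_op_dist A h (dist_of A \<mu> f) = dist_of A \<mu> (mult_op h f)"
proof (rule extensionalityI)
  fix \<phi> assume "\<phi> \<in> Cinf A"
  then show "mult_op_dist A h (dist_of A \<mu> f) \<phi> = dist_of A \<mu> (mult_op h f) \<phi>"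
    using mult_op_in_Cinf[OF A h] by (simp add: mult_op_dist_def dist_of_def mult_op_def ac_simps)
qed (simp_all add: mult_op_dist_def dist_of_def)

lemma mult_op_dist_inverse:
  assumes A: "smooth_atlas A" and "k \<in> Cinf A" and "\<And>x. h x * k x = 1" and u: "u \<in> extensional (Cinf A)"
    and "h \<in> Cinf A"
  shows "mult_op_dist A h (mult_op_dist A k u) = u"
proof (rule extensionalityI[OF _ u])
  fix \<phi> assume "\<phi> \<in> Cinf A"
  moreover have "mult_op k (mult_op h \<phi>) = \<phi>"
  proof
    fix x
    have "mult_op k (mult_op h \<phi>) x = (h x * k x) * \<phi> x" by (simp add: mult_op_def)
    then show "mult_op k (mult_op h \<phi>) x = \<phi> x" using assms(3) by simp
  qed
  ultimately show "mult_op_dist A h (mult_op_dist A k u) \<phi> = u \<phi>"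
    using mult_op_in_Cinf[OF A \<open>h \<in> Cinf A\<close>] by (simp add: mult_op_dist_def)
qed (simp add: mult_op_dist_def)

section \<open>Transfer of hypoellipticity along a conjugation\<close>

text \<open>If \<open>P u\<close> is smooth, so is \<open>k (P u) = R (k u)\<close>; then
  \<open>k u\<close> is smooth by hypothesis on \<open>R\<close>, and so is
  \<open>u = h (k u)\<close>.\<close>

lemma globally_hypoelliptic_conjugate:
  assumes A: "smooth_atlas A" and h: "h \<in> Cinf A" "k \<in> Cinf A" "\<And>x. h x * k x = 1"
    and conj: "\<And>u. u \<in> distributions A \<Longrightarrow> R (mult_op_dist A k u) = mult_op_dist A k (P u)"
    and GH: "globally_hypoelliptic A \<mu> R"
  shows "globally_hypoelliptic A \<mu> P"
  unfolding globally_hypoelliptic_def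
proof (intro ballI impI)
  fix u assume u: "u \<in> distributions A" and "P u \<in> dist_of A \<mu> ` Cinf A"
  then obtain f where "f \<in> Cinf A" "P u = dist_of A \<mu> f" by auto
  then have "R (mult_op_dist A k u) \<in> dist_of A \<mu> ` Cinf A"
    using conj[OF u] mult_op_dist_dist_of[OF A h(2)] mult_op_in_Cinf[OF A h(2)] by simp
  with GH obtain g where "g \<in> Cinf A" "mult_op_dist A k u = dist_of A \<mu> g"
    using mult_op_dist_in_distributions[OF A h(2) u] unfolding globally_hypoelliptic_def by blast
  then have "u = dist_of A \<mu> (mult_op h g)" "mult_op h g \<in> Cinf A"
    using mult_op_dist_inverse[OF A h(2,3) distributionsD(1)[OF u] h(1)]
      mult_op_dist_dist_of[OF A h(1)] mult_op_in_Cinf[OF A h(1)] by auto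
  then show "u \<in> dist_of A \<mu> ` Cinf A" by blast
qed

text \<open>If \<open>v\<close> is the smooth function found for \<open>k u\<close>, then
  \<open>h v\<close> serves for \<open>u\<close>, since \<open>u - h v = h (k u - v)\<close>. Here
  both intertwining relations enter: \<open>conj_k\<close> to pass to \<open>R\<close>, and
  \<open>conj_h\<close> to bring the kernel element back to \<open>P\<close>.\<close>

lemma globally_hypoelliptic_mod_kernel_conjugate:
  assumes A: "smooth_atlas A" and h: "h \<in> Cinf A" "k \<in> Cinf A" "\<And>x. h x * k x = 1"
    and conj_k: "\<And>u. u \<in> distributions A \<Longrightarrow> R (mult_op_dist A k u) = mult_op_dist A k (P u)"
    and conj_h: "\<And>u. u \<in> distributions A \<Longrightarrow> P (mult_op_dist A h u) = mult_op_dist A h (R u)"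
    and GH: "globally_hypoelliptic_mod_kernel A \<mu> R"
  shows "globally_hypoelliptic_mod_kernel A \<mu> P"
  unfolding globally_hypoelliptic_mod_kernel_def
proof (intro ballI impI)
  fix u assume u: "u \<in> distributions A" and "P u \<in> dist_of A \<mu> ` Cinf A"
  then obtain f where "f \<in> Cinf A" "P u = dist_of A \<mu> f" by auto
  then have "R (mult_op_dist A k u) \<in> dist_of A \<mu> ` Cinf A"
    using conj_k[OF u] mult_op_dist_dist_of[OF A h(2)] mult_op_in_Cinf[OF A h(2)] by simp
  with GH obtain v where v: "v \<in> Cinf A"
    "dist_minus A (mult_op_dist A k u) (dist_of A \<mu> v) \<in> kernel A R" (is "?z \<in> _")
    using mult_op_dist_in_distributions[OF A h(2) u]
    unfolding globally_hypoelliptic_mod_kernel_def by blast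
  have hz: "dist_minus A u (dist_of A \<mu> (mult_op h v)) = mult_op_dist A h ?z" (is "?l = ?r")
  proof (rule extensionalityI)
    fix \<phi> assume \<phi>: "\<phi> \<in> Cinf A"
    have "?r \<phi> = mult_op_dist A h (mult_op_dist A k u) \<phi> - mult_op_dist A h (dist_of A \<mu> v) \<phi>"
      using \<phi> mult_op_in_Cinf[OF A h(1) \<phi>] by (simp add: mult_op_dist_def dist_minus_def)
    also have "\<dots> = ?l \<phi>"
      using \<phi> mult_op_dist_inverse[OF A h(2,3) distributionsD(1)[OF u] h(1)]
        mult_op_dist_dist_of[OF A h(1)] by (simp add: dist_minus_def)
    finally show "?l \<phi> = ?r \<phi>" by simp
  qed (simp_all add: mult_op_dist_def dist_minus_def)
  have z: "?z \<in> distributions A" "R ?z = dist_zero A" using v(2) by (auto simp: kernel_def)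
  have "mult_op_dist A h (dist_zero A) = dist_zero A"
    using mult_op_in_Cinf[OF A h(1)] by (auto simp: mult_op_dist_def dist_zero_def fun_eq_iff)
  with z have "P ?r = dist_zero A" by (simp add: conj_h)
  with hz have "?l \<in> kernel A P"
    using mult_op_dist_in_distributions[OF A h(1) z(1)] by (simp add: kernel_def)
  then show "\<exists>v\<in>Cinf A. dist_minus A u (dist_of A \<mu> v) \<in> kernel A P"
    using mult_op_in_Cinf[OF A h(1) v(1)] by blast
qed

section \<open>The conjugation formula and its consequences\<close>

context lie_group_flow
begin

lemma vector_field_exp_mult:
  assumes Q: "Q \<in> Cinf A" "\<And>x. XF Q x = q x - p x" and f: "f \<in> Cinf A"
  shows "XF (\<lambda>x. exp (- Q x) * f x) x = exp (- Q x) * (XF f x - (q x - p x) * f x)"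
  using vector_field_mult[OF Cinf_exp[OF atlas Cinf_uminus[OF atlas Q(1)]] f]
    vector_field_exp[OF Cinf_uminus[OF atlas Q(1)]] vector_field_uminus[OF Q(1)]
  by (simp add: Q(2) algebra_simps)

lemma L_op_conjugate:
  assumes Q: "Q \<in> Cinf A" "\<And>x. XF Q x = q x - p x" and u: "u \<in> Cinf A"
  shows "L_op gmul A expG X q (mult_op (\<lambda>x. exp (- Q x)) u) =
    mult_op (\<lambda>x. exp (- Q x)) (L_op gmul A expG X p u)"
  using vector_field_exp_mult[OF Q u] by (simp add: L_op_def mult_op_def fun_eq_iff algebra_simps)

text \<open>The right-hand side tests \<open>u\<close> against \<open>X (e^{-Q} \<phi>)\<close>, and
  the two terms with \<open>p\<close> cancel. Transposition changes the sign of \<open>X\<close> but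
  also reverses the order of composition, so the factor is \<open>e^{-Q}\<close> as on
  functions.\<close>

lemma L_op_dist_conjugate:
  assumes Q: "Q \<in> Cinf A" "\<And>x. XF Q x = q x - p x" and qp: "q \<in> Cinf A" "p \<in> Cinf A"
    and u: "u \<in> distributions A"
  shows "L_op_dist gmul A expG X q (mult_op_dist A (\<lambda>x. exp (- Q x)) u) =
    mult_op_dist A (\<lambda>x. exp (- Q x)) (L_op_dist gmul A expG X p u)" (is "?l = ?r")
proof (rule extensionalityI)
  fix \<phi> assume \<phi>: "\<phi> \<in> Cinf A"
  let ?E = "\<lambda>x. exp (- Q x)"
  note mult = Cinf_mult[OF atlas]
  have E: "?E \<in> Cinf A" by (rule Cinf_exp[OF atlas Cinf_uminus[OF atlas Q(1)]])
  have X\<phi>: "XF \<phi> \<in> Cinf A" by (rule Cinf_vector_field[OF \<phi>])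
  \<comment> \<open>The expansion is written with binary sums and an explicit factor
    \<open>- 1\<close>, the forms on which additivity and homogeneity of \<open>u\<close>
    act.\<close>
  have "XF (\<lambda>x. ?E x * \<phi> x) =
      (\<lambda>x. (?E x * XF \<phi> x + (- 1) * (?E x * (q x * \<phi> x))) + p x * (?E x * \<phi> x))"
    using vector_field_exp_mult[OF Q \<phi>] by (simp add: fun_eq_iff algebra_simps)
  moreover have "u (\<lambda>x. (?E x * XF \<phi> x + (- 1) * (?E x * (q x * \<phi> x))) + p x * (?E x * \<phi> x)) =
      u (\<lambda>x. ?E x * XF \<phi> x) + (- 1) * u (\<lambda>x. ?E x * (q x * \<phi> x)) + u (\<lambda>x. p x * (?E x * \<phi> x))"
    using distributionsD(3)[OF u mult[OF E mult[OF qp(1) \<phi>]], of "- 1"]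
      distributionsD(2)[OF u mult[OF E X\<phi>] mult[OF Cinf_const[OF atlas, of "- 1"] mult[OF E mult[OF qp(1) \<phi>]]]]
      distributionsD(2)[OF u Cinf_add[OF atlas mult[OF E X\<phi>]
          mult[OF Cinf_const[OF atlas, of "- 1"] mult[OF E mult[OF qp(1) \<phi>]]]] mult[OF qp(2) mult[OF E \<phi>]]]
    by simp
  ultimately show "?l \<phi> = ?r \<phi>"
    using \<phi> X\<phi> mult[OF E \<phi>] mult[OF qp(1) \<phi>]
    by (simp add: L_op_dist_def mult_op_dist_def mult_op_def)
qed (simp_all add: L_op_dist_def mult_op_dist_def)

lemma hypoelliptic_transfer:
  assumes Q: "Q \<in> Cinf A" "\<And>x. XF Q x = q x - p x" and qp: "q \<in> Cinf A" "p \<in> Cinf A"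
  shows "globally_hypoelliptic A \<mu> (L_op_dist gmul A expG X p) \<Longrightarrow>
      globally_hypoelliptic A \<mu> (L_op_dist gmul A expG X q)"
    and "globally_hypoelliptic_mod_kernel A \<mu> (L_op_dist gmul A expG X p) \<Longrightarrow>
      globally_hypoelliptic_mod_kernel A \<mu> (L_op_dist gmul A expG X q)"
proof -
  have nQ: "(\<lambda>x. - Q x) \<in> Cinf A" "XF (\<lambda>x. - Q x) x = p x - q x" for x
    using Cinf_uminus[OF atlas Q(1)] vector_field_uminus[OF Q(1)] Q(2) by auto
  \<comment> \<open>The inverse factor is kept as \<open>exp (- (- Q x))\<close>, so that it matches
    literally the conjugation formula for \<open>- Q\<close>.\<close>
  have E: "(\<lambda>x. exp (- Q x)) \<in> Cinf A" "(\<lambda>x. exp (- (- Q x))) \<in> Cinf A"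
    "exp (- Q x) * exp (- (- Q x)) = 1" for x
    using Cinf_exp[OF atlas nQ(1)] Cinf_exp[OF atlas Q(1)] by (auto simp: exp_minus)
  note conj = L_op_dist_conjugate[OF Q qp] and conj' = L_op_dist_conjugate[OF nQ qp(2,1)]
  show "globally_hypoelliptic A \<mu> (L_op_dist gmul A expG X p) \<Longrightarrow>
      globally_hypoelliptic A \<mu> (L_op_dist gmul A expG X q)"
    by (rule globally_hypoelliptic_conjugate[OF atlas E, where R = "L_op_dist gmul A expG X p"])
      (rule conj')
  show "globally_hypoelliptic_mod_kernel A \<mu> (L_op_dist gmul A expG X p) \<Longrightarrow>
      globally_hypoelliptic_mod_kernel A \<mu> (L_op_dist gmul A expG X q)"
    by (rule globally_hypoelliptic_mod_kernel_conjugate[OF atlas E,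
          where R = "L_op_dist gmul A expG X p"]) (rule conj' conj, assumption)+
qed

end

theorem proposition5p8:
  fixes gmul :: "'g::{t2_space,second_countable_topology} \<Rightarrow> 'g \<Rightarrow> 'g"
    and e :: 'g and inver :: "'g \<Rightarrow> 'g"
    and A :: "('g, 'e::real_inner) atlas"
    and expG :: "(('g \<Rightarrow> real) \<Rightarrow> real) \<Rightarrow> 'g"
    and \<mu> :: "'g measure"
    and X :: "('g \<Rightarrow> real) \<Rightarrow> real"
    and q Q :: "'g \<Rightarrow> complex" and q0 :: complex
  assumes "compact_lie_group gmul e inver A"
    and "exponential_map gmul e A expG"
    and "normalized_haar gmul \<mu>"
    and "X \<in> lie_algebra e A"
    and "q \<in> Cinf A"
    and "q0 = (\<integral>x. q x \<partial>\<mu>)"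
    and "Q \<in> Cinf A"
    and "\<And>x. vector_field gmul A expG X Q x = q x - q0"
  shows "((\<forall>u\<in>Cinf A.
            L_op gmul A expG X q (mult_op (\<lambda>x. exp (- Q x)) u) =
            mult_op (\<lambda>x. exp (- Q x)) (L_op gmul A expG X (\<lambda>_. q0) u)) \<and>
         (\<forall>u\<in>distributions A.
            L_op_dist gmul A expG X q (mult_op_dist A (\<lambda>x. exp (- Q x)) u) =
            mult_op_dist A (\<lambda>x. exp (- Q x)) (L_op_dist gmul A expG X (\<lambda>_. q0) u))) \<and>
         (globally_hypoelliptic A \<mu> (L_op_dist gmul A expG X q) \<longleftrightarrow>
         globally_hypoelliptic A \<mu> (L_op_dist gmul A expG X (\<lambda>_. q0))) \<and>
         (globally_hypoelliptic_mod_kernel A \<mu> (L_op_dist gmul A expG X q) \<longleftrightarrow>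
         globally_hypoelliptic_mod_kernel A \<mu> (L_op_dist gmul A expG X (\<lambda>_. q0)))"
proof -
  interpret lie_group_flow gmul e inver A expG X
    using assms(1,2,4) by unfold_locales
  note q0 = Cinf_const[OF atlas, of q0]
  have nQ: "(\<lambda>x. - Q x) \<in> Cinf A" "XF (\<lambda>x. - Q x) x = q0 - q x" for x
    using Cinf_uminus[OF atlas assms(7)] vector_field_uminus[OF assms(7)] assms(8) by auto
  show ?thesis
    using L_op_conjugate[OF assms(7,8)] L_op_dist_conjugate[OF assms(7,8,5) q0]
      hypoelliptic_transfer[OF assms(7,8,5) q0] hypoelliptic_transfer[OF nQ q0 assms(5)]
    by blast
qed

end
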